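(* Let $X\in\mathbb{R}^{n\times d_x}$, $Y\in\mathbb{R}^{n\times d_y}$, $\lambda_x,\lambda_y\ge 0$, and set $\Sigma_{xx}=X^{T}X+\lambda_xI_{d_x}$, $\Sigma_{yy}=Y^{T}Y+\lambda_yI_{d_y}$, $\Sigma_{xy}=X^{T}Y$, $\Sigma=\mathrm{blkdiag}(\Sigma_{xx},\Sigma_{yy})$, $d=d_x+d_y$. Assume that $\Sigma$ is symmetric positive definite and that the two largest canonical correlations satisfy $\sigma_1-\sigma_2>0$. Let $\mathbb{S}_{xy}=\{u\in\mathbb{R}^{d_x}:u^{T}\Sigma_{xx}u=1\}\times\{v\in\mathbb{R}^{d_y}:v^{T}\Sigma_{yy}v=1\}$, viewed as a submanifold of $\mathbb{R}^{d}$ via $z=[u^{T},v^{T}]^{T}$, and let $f:\mathbb{S}_{xy}\to\mathbb{R}$, $$f(z)=-\frac12 z^{T}\begin{bmatrix}0&\Sigma_{xy}\\ \Sigma_{xy}^{T}&0\end{bmatrix}z=-u^{T}\Sigma_{xy}v.$$ Let $z^{\star}=[u_1^{T},v_1^{T}]^{T}$ be the optimal point with $u_1=\Sigma_{xx}^{-1/2}\phi$, $v_1=\Sigma_{yy}^{-1/2}\psi$, where $\phi,\psi$ are left and right unit singular vectors of $\Sigma_{xx}^{-1/2}\Sigma_{xy}\Sigma_{yy}^{-1/2}$ corresponding to its largest singular value $\sigma_1$. Suppose $\mathbb{S}_{xy}$ is equipped with the Riemannian metric $g_z(\xi_z,\eta_z)=\xi_z^{T}M_z\eta_z$ defined by a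 smooth preconditioning scheme $z\mapsto M_z$. (i) If $M_{z^{\star}}=\Sigma$, then the condition number of the Riemannian Hessian of $f$ on $\mathbb{S}_{xy}$ at $z^{\star}$ equals $\dfrac{\sigma_1+\sigma_2}{\sigma_1-\sigma_2}$. (ii) For general $M_{z^{\star}}$ (thought of as $M_{z^{\star}}\approx\Sigma$), the condition number of the Riemannian Hessian of $f$ on $\mathbb{S}_{xy}$ at $z^{\star}$ is at most $\dfrac{\sigma_1+\sigma_2}{\sigma_1-\sigma_2}\cdot\kappa(\Sigma,M_{z^{\star}})$.
   Context: The canonical correlations $\sigma_1\ge\sigma_2\ge\dots\ge\sigma_q\geq 0$ are the singular values of $\Sigma_{xx}^{-1/2}\Sigma_{xy}\Sigma_{yy}^{-1/2}$, with $q=\max(\mathrm{rank}\,\Sigma_{xx},\mathrm{rank}\,\Sigma_{yy})$, padded by zeros (i.e. $\sigma_i=0$ for $i>\min(d_x,d_y)$); it is implicit that $q\ge 2$ so that $\sigma_2$ makes sense. A smooth preconditioning scheme is a smooth mapping $z\mapsto M_z=\mathrm{blkdiag}(M_u^{(xx)},M_v^{(yy)})$, where $u\mapsto M^{(xx)}_u\in\mathbb{R}^{d_x\times d_x}$ and $v\mapsto M^{(yy)}_v\in\mathbb{R}^{d_y\times d_y}$ are smooth with symmetric positive definite values; $\mathbb{S}_{xy}$ is a Riemannian submanifold of $\mathbb{R}^{d}$ with the metric $\xi^{T}M_z\eta$. The Riemannian Hessian of $f$ at $z$ is the linear map $\eta_z\mapsto\nabla_{\eta_z}\mathrm{grad}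 f$ on $T_z\mathbb{S}_{xy}$ ($\nabla$ the Levi-Civita connection); it is self-adjoint with respect to $g_z$, and its condition number is the ratio between its largest and smallest eigenvalues in absolute value. For a symmetric matrix $A$ and a symmetric positive definite matrix $C$, the generalized eigenvalues of the pencil $(A,C)$ are the $\lambda$ with $Av=\lambda Cv$ for some $v\ne 0$, and $\kappa(A,C)$ is the ratio between the largest and smallest generalized eigenvalues of $(A,C)$ in absolute value. $C^{1/2}$ is the symmetric positive definite square root, $C^{-1/2}$ its inverse. *)

theory Defs
  imports "HOL-Analysis.Analysis" "HOL-Library.Multiset"
begin

section \<open>Matrices\<close>

definition spd :: "real^'n^'n \<Rightarrow> bool" where
  "spd A \<longleftrightarrow> transpose A = A \<and> (\<forall>x. x \<noteq> 0 \<longrightarrow> x \<bullet> (A *v x) > 0)"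

definition spd_sqrt :: "real^'n^'n \<Rightarrow> real^'n^'n" where
  "spd_sqrt C = (THE B. spd B \<and> B ** B = C)"

definition inv_sqrt :: "real^'n^'n \<Rightarrow> real^'n^'n" where
  "inv_sqrt C = matrix_inv (spd_sqrt C)"

definition vec_join :: "real^'m \<Rightarrow> real^'n \<Rightarrow> real^('m + 'n)" where
  "vec_join u v = (\<chi> i. case i of Inl a \<Rightarrow> u $ a | Inr b \<Rightarrow> v $ b)"

definition block_matrix ::
  "real^'m^'m \<Rightarrow> real^'n^'m \<Rightarrow> real^'m^'n \<Rightarrow> real^'n^'n \<Rightarrow> real^('m + 'n)^('m + 'n)" where
  "block_matrix A B C D = (\<chi> i j. case i of
      Inl a \<Rightarrow> (case j of Inl a' \<Rightarrow> A $ a $ a' | Inr b' \<Rightarrow> B $ a $ b')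
    | Inr b \<Rightarrow> (case j of Inl a' \<Rightarrow> C $ b $ a' | Inr b' \<Rightarrow> D $ b $ b'))"

definition blkdiag :: "real^'m^'m \<Rightarrow> real^'n^'n \<Rightarrow> real^('m + 'n)^('m + 'n)" where
  "blkdiag A D = block_matrix A 0 0 D"

definition singular_space :: "real^'n^'m \<Rightarrow> real \<Rightarrow> (real^'n) set" where
  "singular_space A s = {v. transpose A *v (A *v v) = s\<^sup>2 *\<^sub>R v}"

text \<open>The nonnegative square roots of the eigenvalues of \<open>A\<^sup>T A\<close>, each repeated according to its
  multiplicity; the index set of the sum is finite. \<open>singular_value A i\<close> is the \<open>i\<close>-th largest of
  them, counted from \<open>i = 1\<close>, and \<open>0\<close> once they are exhausted.\<close>

definition singular_values :: "real^'n^'m \<Rightarrow> real multiset" where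
  "singular_values A =
    (\<Sum>s\<in>{s. 0 \<le> s \<and> singular_space A s \<noteq> {0}}. replicate_mset (dim (singular_space A s)) s)"

definition singular_value :: "real^'n^'m \<Rightarrow> nat \<Rightarrow> real" where
  "singular_value A i =
    (let L = rev (sorted_list_of_multiset (singular_values A))
     in if 1 \<le> i \<and> i \<le> length L then L ! (i - 1) else 0)"

definition unit_singular_vectors :: "real^'n^'m \<Rightarrow> real \<Rightarrow> real^'m \<Rightarrow> real^'n \<Rightarrow> bool" where
  "unit_singular_vectors A s \<phi> \<psi> \<longleftrightarrow>
    norm \<phi> = 1 \<and> norm \<psi> = 1 \<and> A *v \<psi> = s *\<^sub>R \<phi> \<and> transpose A *v \<phi> = s *\<^sub>R \<psi>"

definition abs_ratio :: "real set \<Rightarrow> real" where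
  "abs_ratio E = Max (abs ` E) / Min (abs ` E)"

definition pencil_eigenvalues :: "real^'n^'n \<Rightarrow> real^'n^'n \<Rightarrow> real set" where
  "pencil_eigenvalues A C = {\<mu>. \<exists>v. v \<noteq> 0 \<and> A *v v = \<mu> *\<^sub>R (C *v v)}"

definition pencil_cond :: "real^'n^'n \<Rightarrow> real^'n^'n \<Rightarrow> real" where
  "pencil_cond A C = abs_ratio (pencil_eigenvalues A C)"

definition eigenvalues_on :: "'a::real_vector set \<Rightarrow> ('a \<Rightarrow> 'a) \<Rightarrow> real set" where
  "eigenvalues_on T H = {\<mu>. \<exists>\<eta>\<in>T. \<eta> \<noteq> 0 \<and> H \<eta> = \<mu> *\<^sub>R \<eta>}"

definition condition_number_on :: "'a::real_vector set \<Rightarrow> ('a \<Rightarrow> 'a) \<Rightarrow> real" where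
  "condition_number_on T H = abs_ratio (eigenvalues_on T H)"


section \<open>Smooth maps on submanifolds of a Euclidean space\<close>

fun times_differentiable_on ::
  "nat \<Rightarrow> 'a::real_normed_vector set \<Rightarrow> ('a \<Rightarrow> 'b::real_normed_vector) \<Rightarrow> bool" where
  "times_differentiable_on 0 U F \<longleftrightarrow> continuous_on U F"
| "times_differentiable_on (Suc k) U F \<longleftrightarrow>
    (\<forall>x\<in>U. F differentiable (at x)) \<and>
    (\<forall>v. times_differentiable_on k U (\<lambda>x. frechet_derivative F (at x) v))"

text \<open>\<open>smooth_open U F\<close> is meant for open \<open>U\<close> in a finite-dimensional domain.\<close>

definition smooth_open ::
  "'a::real_normed_vector set \<Rightarrow> ('a \<Rightarrow> 'b::real_normed_vector) \<Rightarrow> bool" where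
  "smooth_open U F \<longleftrightarrow> (\<forall>k. times_differentiable_on k U F)"

text \<open>In the rest of this section \<open>S\<close> is an embedded submanifold of \<open>'a\<close>. Functions on \<open>S\<close> are
  represented by total functions; all notions below depend only on their values on \<open>S\<close>.\<close>

definition smooth_map :: "'a::euclidean_space set \<Rightarrow> ('a \<Rightarrow> 'b::real_normed_vector) \<Rightarrow> bool" where
  "smooth_map S h \<longleftrightarrow>
    (\<forall>z\<in>S. \<exists>U F. open U \<and> z \<in> U \<and> smooth_open U F \<and> (\<forall>x\<in>U \<inter> S. F x = h x))"

definition curve_through ::
  "'a::euclidean_space set \<Rightarrow> 'a \<Rightarrow> 'a \<Rightarrow> (real \<Rightarrow> 'a) \<Rightarrow> bool" where
  "curve_through S z \<xi> \<gamma> \<longleftrightarrow>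
    (\<exists>e>0. smooth_open {-e<..<e} \<gamma> \<and> \<gamma> ` {-e<..<e} \<subseteq> S) \<and>
    \<gamma> 0 = z \<and> (\<gamma> has_vector_derivative \<xi>) (at 0)"

definition tangent_space :: "'a::euclidean_space set \<Rightarrow> 'a \<Rightarrow> 'a set" where
  "tangent_space S z = {\<xi>. \<exists>\<gamma>. curve_through S z \<xi> \<gamma>}"

definition dir_deriv ::
  "'a::euclidean_space set \<Rightarrow> ('a \<Rightarrow> 'b::real_normed_vector) \<Rightarrow> 'a \<Rightarrow> 'a \<Rightarrow> 'b" where
  "dir_deriv S h z \<xi> =
    (THE d. \<forall>\<gamma>. curve_through S z \<xi> \<gamma> \<longrightarrow> ((\<lambda>t. h (\<gamma> t)) has_vector_derivative d) (at 0))"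

definition vector_field :: "'a::euclidean_space set \<Rightarrow> ('a \<Rightarrow> 'a) \<Rightarrow> bool" where
  "vector_field S V \<longleftrightarrow> smooth_map S V \<and> (\<forall>z\<in>S. V z \<in> tangent_space S z)"

definition lie_bracket ::
  "'a::euclidean_space set \<Rightarrow> ('a \<Rightarrow> 'a) \<Rightarrow> ('a \<Rightarrow> 'a) \<Rightarrow> 'a \<Rightarrow> 'a" where
  "lie_bracket S V W z = dir_deriv S W z (V z) - dir_deriv S V z (W z)"


section \<open>Levi-Civita connection, gradient and Hessian\<close>

text \<open>\<open>D V W\<close> stands for \<open>\<nabla>\<^sub>V W\<close>. Compatibility with equality on \<open>S\<close> and real linearity
  in \<open>W\<close> follow from the listed laws, taking for \<open>h\<close> the indicator of the complement of \<open>S\<close>,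
  respectively a constant.\<close>

definition affine_connection ::
  "'a::euclidean_space set \<Rightarrow> (('a \<Rightarrow> 'a) \<Rightarrow> ('a \<Rightarrow> 'a) \<Rightarrow> 'a \<Rightarrow> 'a) \<Rightarrow> bool" where
  "affine_connection S D \<longleftrightarrow>
    (\<forall>V W. vector_field S V \<and> vector_field S W \<longrightarrow> vector_field S (D V W)) \<and>
    (\<forall>V V' W. vector_field S V \<and> vector_field S V' \<and> vector_field S W \<longrightarrow>
      (\<forall>z\<in>S. D (\<lambda>x. V x + V' x) W z = D V W z + D V' W z)) \<and>
    (\<forall>V W W'. vector_field S V \<and> vector_field S W \<and> vector_field S W' \<longrightarrow>
      (\<forall>z\<in>S. D V (\<lambda>x. W x + W' x) z = D V W z + D V W' z)) \<and>
    (\<forall>(h::'a \<Rightarrow> real) V W. smooth_map S h \<and> vector_field S V \<and> vector_field S W \<longrightarrow>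
      (\<forall>z\<in>S. D (\<lambda>x. h x *\<^sub>R V x) W z = h z *\<^sub>R D V W z)) \<and>
    (\<forall>(h::'a \<Rightarrow> real) V W. smooth_map S h \<and> vector_field S V \<and> vector_field S W \<longrightarrow>
      (\<forall>z\<in>S. D V (\<lambda>x. h x *\<^sub>R W x) z = dir_deriv S h z (V z) *\<^sub>R W z + h z *\<^sub>R D V W z))"

definition levi_civita ::
  "'a::euclidean_space set \<Rightarrow> ('a \<Rightarrow> 'a \<Rightarrow> 'a \<Rightarrow> real) \<Rightarrow>
   (('a \<Rightarrow> 'a) \<Rightarrow> ('a \<Rightarrow> 'a) \<Rightarrow> 'a \<Rightarrow> 'a) \<Rightarrow> bool" where
  "levi_civita S g D \<longleftrightarrow>
    affine_connection S D \<and>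
    (\<forall>V W. vector_field S V \<and> vector_field S W \<longrightarrow>
      (\<forall>z\<in>S. D V W z - D W V z = lie_bracket S V W z)) \<and>
    (\<forall>V W Z. vector_field S V \<and> vector_field S W \<and> vector_field S Z \<longrightarrow>
      (\<forall>z\<in>S. dir_deriv S (\<lambda>x. g x (W x) (Z x)) z (V z) =
         g z (D V W z) (Z z) + g z (W z) (D V Z z)))"

definition riemannian_grad ::
  "'a::euclidean_space set \<Rightarrow> ('a \<Rightarrow> 'a \<Rightarrow> 'a \<Rightarrow> real) \<Rightarrow> ('a \<Rightarrow> real) \<Rightarrow> 'a \<Rightarrow> 'a" where
  "riemannian_grad S g f z =
    (THE \<zeta>. \<zeta> \<in> tangent_space S z \<and> (\<forall>\<xi>\<in>tangent_space S z. g z \<zeta> \<xi> = dir_deriv S f z \<xi>))"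

text \<open>\<open>\<nabla>\<^sub>\<eta> grad f\<close> for a single tangent vector \<open>\<eta>\<close> at \<open>z\<close>: the value at \<open>z\<close> of \<open>\<nabla>\<^sub>V grad f\<close>,
  which is the same for all vector fields \<open>V\<close> extending \<open>\<eta>\<close>.\<close>

definition riemannian_hessian ::
  "'a::euclidean_space set \<Rightarrow> ('a \<Rightarrow> 'a \<Rightarrow> 'a \<Rightarrow> real) \<Rightarrow>
   (('a \<Rightarrow> 'a) \<Rightarrow> ('a \<Rightarrow> 'a) \<Rightarrow> 'a \<Rightarrow> 'a) \<Rightarrow> ('a \<Rightarrow> real) \<Rightarrow> 'a \<Rightarrow> 'a \<Rightarrow> 'a" where
  "riemannian_hessian S g D f z \<eta> =
    (THE w. \<forall>V. vector_field S V \<and> V z = \<eta> \<longrightarrow> D V (riemannian_grad S g f) z = w)"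


section \<open>Products of ellipsoids and preconditioning\<close>

definition ellipsoid :: "real^'n^'n \<Rightarrow> (real^'n) set" where
  "ellipsoid A = {u. u \<bullet> (A *v u) = 1}"

definition join_set :: "(real^'m) set \<Rightarrow> (real^'n) set \<Rightarrow> (real^('m + 'n)) set" where
  "join_set P Q = {vec_join u v | u v. u \<in> P \<and> v \<in> Q}"

definition smooth_preconditioning ::
  "(real^'m) set \<Rightarrow> (real^'n) set \<Rightarrow> (real^('m + 'n) \<Rightarrow> real^('m + 'n)^('m + 'n)) \<Rightarrow> bool" where
  "smooth_preconditioning P Q M \<longleftrightarrow>
    (\<exists>Mxx Myy. smooth_map P Mxx \<and> (\<forall>u\<in>P. spd (Mxx u)) \<and>
      smooth_map Q Myy \<and> (\<forall>v\<in>Q. spd (Myy v)) \<and>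
      (\<forall>u\<in>P. \<forall>v\<in>Q. M (vec_join u v) = blkdiag (Mxx u) (Myy v)))"

definition precond_metric ::
  "(real^'d \<Rightarrow> real^'d^'d) \<Rightarrow> real^'d \<Rightarrow> real^'d \<Rightarrow> real^'d \<Rightarrow> real" where
  "precond_metric M z \<xi> \<eta> = \<xi> \<bullet> (M z *v \<eta>)"

end

theory Submission
  imports Defs
begin

text \<open>
  The objective is \<open>f z = - (1/2) z\<^sup>T B z\<close> with \<open>B\<close> the off-diagonal block matrix of \<open>\<Sigma>xy\<close>, and its
  gradient vanishes at \<open>z\<^sup>*\<close>. For a tangent vector \<open>\<eta>\<close> at \<open>z\<^sup>*\<close> and a tangent field \<open>W\<close>, compatibility
  of the connection with the metric therefore gives
  \<open>g(\<nabla>\<^sub>\<eta> grad f, W) = \<eta>(g(grad f, W)) = \<eta>(df(W))\<close>, where \<open>df(W) x = - x\<^sup>T B W(x)\<close>.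
  A tangent field satisfies \<open>x\<^sup>T \<Sigma> W(x) = 0\<close> on the manifold, so that \<open>df(W) x = x\<^sup>T K W(x)\<close> with
  \<open>K = \<sigma>\<^sub>1 \<Sigma> - B\<close>. The multiple \<open>\<sigma>\<^sub>1\<close> is the Lagrange multiplier: the singular vector equations say
  \<open>K z\<^sup>* = 0\<close>. Differentiating \<open>x\<^sup>T K W(x)\<close> at \<open>z\<^sup>*\<close> along \<open>\<eta>\<close> then leaves \<open>\<eta>\<^sup>T K W(z\<^sup>*)\<close>, and the
  Hessian is the operator that represents the form \<open>K\<close>, restricted to the tangent space \<open>T\<close>, by means
  of the inner product \<open>M z\<^sup>*\<close> (\<open>hessian_at_critical_point\<close>, \<open>hessian_eigenvalues\<close>).

  What remains is a comparison of three quadratic forms on \<open>T\<close>. In the coordinates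
  \<open>\<xi> = (\<Sigma>xx\<^sup>-\<^sup>1\<^sup>/\<^sup>2 a, \<Sigma>yy\<^sup>-\<^sup>1\<^sup>/\<^sup>2 b)\<close> the space \<open>T\<close> is \<open>a \<bottom> \<phi>, b \<bottom> \<psi>\<close>, the form \<open>\<Sigma>\<close> is
  \<open>|a|\<^sup>2 + |b|\<^sup>2\<close>, and \<open>K\<close> is \<open>\<sigma>\<^sub>1 (|a|\<^sup>2 + |b|\<^sup>2) - 2 a\<^sup>T R b\<close>. On the complement of \<open>\<psi>\<close> the operator
  \<open>R\<close> has norm at most \<open>\<sigma>\<^sub>2\<close> (\<open>operator_bound_orthogonal\<close>), hence
  \<open>(\<sigma>\<^sub>1 - \<sigma>\<^sub>2) \<Sigma> \<le> K \<le> (\<sigma>\<^sub>1 + \<sigma>\<^sub>2) \<Sigma>\<close> on \<open>T\<close> (\<open>K_bounds\<close>). Both bounds are attained, at \<open>(a, \<plusminus>b)\<close> for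
  a pair of singular vectors of \<open>\<sigma>\<^sub>2\<close> (\<open>extreme_eigenvalues\<close>); this is part (i). Part (ii) follows by
  multiplying with the extreme generalized eigenvalues of \<open>\<Sigma>\<close> relative to \<open>M z\<^sup>*\<close>
  (\<open>preconditioned_eigenvalue_bounds\<close>).

  Three ingredients carry this. The gradient has to be a smooth field before the connection may be
  applied to it; it is a rational function of \<open>z\<close> and of the entries of the preconditioner, so a
  calculus of smooth maps closed under products and quotients suffices. The eigenvalues all come
  from minimising Rayleigh quotients on subspaces, which also yields the square roots of the
  covariance matrices and the second singular value. Finally, tangent spaces and directional
  derivatives are computed from explicit curves on the ellipsoids.
\<close>

section \<open>Calculus of smooth maps\<close>

text \<open>The recursion in \<open>times_differentiable_on\<close> applies \<open>frechet_derivative\<close> to a total function, while the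
  differentiation rules describe it on \<open>U\<close> only. Openness of \<open>U\<close> makes the values on \<open>U\<close> decisive.\<close>

lemma times_differentiable_on_cong:
  assumes "open U" "\<And>x. x \<in> U \<Longrightarrow> F x = G x" "times_differentiable_on k U F"
  shows "times_differentiable_on k U G"
  using assms(2,3)
proof (induction k arbitrary: F G)
  case 0
  then show ?case by (auto simp: continuous_on_cong[of U U F G])
next
  case (Suc k)
  have d: "(G has_derivative frechet_derivative F (at x)) (at x)" if "x \<in> U" for x
  proof (rule has_derivative_transform_within_open[OF _ \<open>open U\<close> that])
    show "(F has_derivative frechet_derivative F (at x)) (at x)"
      using Suc.prems(2) that by (simp add: frechet_derivative_works)
  qed (use Suc.prems(1) in auto)
  have e: "frechet_derivative F (at x) = frechet_derivative G (at x)" if "x \<in> U" for x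
    using frechet_derivative_at[OF d[OF that]] .
  have "times_differentiable_on k U (\<lambda>x. frechet_derivative G (at x) v)" for v
  proof (rule Suc.IH)
    show "times_differentiable_on k U (\<lambda>x. frechet_derivative F (at x) v)"
      using Suc.prems(2) by simp
  qed (simp only: e)
  with d show ?case unfolding times_differentiable_on.simps differentiable_def by blast
qed

text \<open>One step of the recursion, for a derivative that is known by a formula.\<close>

lemma times_differentiable_on_SucI:
  assumes "open U" "\<And>x. x \<in> U \<Longrightarrow> (F has_derivative F' x) (at x)"
    "\<And>v. times_differentiable_on k U (\<lambda>x. F' x v)"
  shows "times_differentiable_on (Suc k) U F"
proof -
  have "times_differentiable_on k U (\<lambda>x. frechet_derivative F (at x) v)" for v
    by (rule times_differentiable_on_cong[OF \<open>open U\<close> _ assms(3)[of v]])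
       (use frechet_derivative_at[OF assms(2)] in auto)
  with assms(2) show ?thesis unfolding times_differentiable_on.simps differentiable_def by blast
qed

lemma times_differentiable_on_SucD:
  assumes "times_differentiable_on (Suc k) U F"
  shows "x \<in> U \<Longrightarrow> (F has_derivative frechet_derivative F (at x)) (at x)"
    "times_differentiable_on k U (\<lambda>x. frechet_derivative F (at x) v)"
  using assms by (auto simp: frechet_derivative_works)

lemma times_differentiable_on_pred:
  "times_differentiable_on (Suc k) U F \<Longrightarrow> times_differentiable_on k U F"
proof (induction k arbitrary: F)
  case 0
  then show ?case
    by (auto intro!: continuous_at_imp_continuous_on differentiable_imp_continuous_within)
next
  case (Suc k)
  then show ?case by auto
qed

lemma times_differentiable_on_const: "times_differentiable_on k U (\<lambda>x. c)"
proof (induction k arbitrary: c)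
  case (Suc k)
  then show ?case by (simp add: frechet_derivative_const)
qed simp

lemma times_differentiable_on_linear:
  assumes "open U" "bounded_linear L" "times_differentiable_on k U F"
  shows "times_differentiable_on k U (\<lambda>x. L (F x))"
  using assms(3)
proof (induction k arbitrary: F)
  case 0
  then show ?case using bounded_linear.continuous_on[OF assms(2)] by auto
next
  case (Suc k)
  note F = times_differentiable_on_SucD[OF Suc.prems]
  show ?case
    by (rule times_differentiable_on_SucI[OF \<open>open U\<close> bounded_linear.has_derivative[OF assms(2) F(1)] Suc.IH[OF F(2)]])
qed

lemma times_differentiable_on_compose_linear:
  assumes "open U" "bounded_linear L" "times_differentiable_on k U F"
  shows "times_differentiable_on k (L -` U) (\<lambda>x. F (L x))"
  using assms(3)
proof (induction k arbitrary: F)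
  case 0
  then show ?case
    using continuous_on_compose2[of U F "L -` U" L] linear_continuous_on[OF assms(2)] by auto
next
  case (Suc k)
  note F = times_differentiable_on_SucD[OF Suc.prems]
  have o: "open (L -` U)"
    using open_vimage[OF \<open>open U\<close>] assms(2) linear_continuous_on by blast
  have "((\<lambda>x. F (L x)) has_derivative (\<lambda>v. frechet_derivative F (at (L x)) (L v))) (at x)"
    if "x \<in> L -` U" for x
    using that by (intro has_derivative_compose[OF bounded_linear_imp_has_derivative[OF assms(2)]] F(1)) simp
  then show ?case
    by (rule times_differentiable_on_SucI[OF o _ Suc.IH[OF F(2)]])
qed

lemma times_differentiable_on_add:
  assumes "open U" "times_differentiable_on k U F" "times_differentiable_on k U G"
  shows "times_differentiable_on k U (\<lambda>x. F x + G x)"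
  using assms(2,3)
proof (induction k arbitrary: F G)
  case 0
  then show ?case by (auto intro: continuous_on_add)
next
  case (Suc k)
  note F = times_differentiable_on_SucD[OF Suc.prems(1)]
    and G = times_differentiable_on_SucD[OF Suc.prems(2)]
  show ?case
    by (rule times_differentiable_on_SucI[OF \<open>open U\<close> has_derivative_add[OF F(1) G(1)] Suc.IH[OF F(2) G(2)]])
qed

text \<open>By the product rule the derivative is again a sum of products, each with one factor
  differentiated; the other factor loses one order by \<open>times_differentiable_on_pred\<close>.\<close>

lemma times_differentiable_on_bilinear:
  assumes "open U" "bounded_bilinear P" "times_differentiable_on k U F" "times_differentiable_on k U G"
  shows "times_differentiable_on k U (\<lambda>x. P (F x) (G x))"
  using assms(3,4)
proof (induction k arbitrary: F G)
  case 0
  then show ?case using bounded_bilinear.continuous_on[OF assms(2)] by auto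
next
  case (Suc k)
  note F = times_differentiable_on_SucD[OF Suc.prems(1)]
    and G = times_differentiable_on_SucD[OF Suc.prems(2)]
    and FG = Suc.prems[THEN times_differentiable_on_pred]
  show ?case
    by (rule times_differentiable_on_SucI[OF \<open>open U\<close> bounded_bilinear.FDERIV[OF assms(2) F(1) G(1)]
          times_differentiable_on_add[OF \<open>open U\<close> Suc.IH[OF FG(1) G(2)] Suc.IH[OF F(2) FG(2)]]])
qed

text \<open>The derivative \<open>- F\<^sup>-\<^sup>1 F' F\<^sup>-\<^sup>1\<close> is a product that contains the inverse itself, but only to the
  order already reached by the induction.\<close>

lemma times_differentiable_on_inverse:
  fixes F :: "'a::real_normed_vector \<Rightarrow> real"
  assumes "open U" "times_differentiable_on k U F" "\<And>x. x \<in> U \<Longrightarrow> F x \<noteq> 0"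
  shows "times_differentiable_on k U (\<lambda>x. inverse (F x))"
  using assms(2)
proof (induction k)
  case 0
  then show ?case using assms(3) by (auto intro: continuous_on_inverse)
next
  case (Suc k)
  note F = times_differentiable_on_SucD[OF Suc.prems]
    and inv = Suc.IH[OF times_differentiable_on_pred[OF Suc.prems]]
    and mult = times_differentiable_on_bilinear[OF \<open>open U\<close> bounded_bilinear_mult]
  have "times_differentiable_on k U
      (\<lambda>x. (- 1) * (inverse (F x) * frechet_derivative F (at x) v * inverse (F x)))" for v
    by (rule mult[OF times_differentiable_on_const mult[OF mult[OF inv F(2)] inv]])
  then have "times_differentiable_on k U
      (\<lambda>x. - (inverse (F x) * frechet_derivative F (at x) v * inverse (F x)))" for v
    by simp
  with Deriv.has_derivative_inverse[OF assms(3) F(1)] show ?case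
    by (intro times_differentiable_on_SucI[OF \<open>open U\<close>])
qed

lemma smooth_open_const: "smooth_open U (\<lambda>x. c)"
  by (simp add: smooth_open_def times_differentiable_on_const)

lemma smooth_open_linear:
  "open U \<Longrightarrow> bounded_linear L \<Longrightarrow> smooth_open U F \<Longrightarrow> smooth_open U (\<lambda>x. L (F x))"
  by (simp add: smooth_open_def times_differentiable_on_linear)

lemma smooth_open_add:
  "open U \<Longrightarrow> smooth_open U F \<Longrightarrow> smooth_open U G \<Longrightarrow> smooth_open U (\<lambda>x. F x + G x)"
  by (simp add: smooth_open_def times_differentiable_on_add)

lemma smooth_open_bilinear:
  "open U \<Longrightarrow> bounded_bilinear P \<Longrightarrow> smooth_open U F \<Longrightarrow> smooth_open U G \<Longrightarrow>
    smooth_open U (\<lambda>x. P (F x) (G x))"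
  by (simp add: smooth_open_def times_differentiable_on_bilinear)

lemma smooth_open_inverse:
  fixes F :: "'a::real_normed_vector \<Rightarrow> real"
  shows "open U \<Longrightarrow> smooth_open U F \<Longrightarrow> (\<And>x. x \<in> U \<Longrightarrow> F x \<noteq> 0) \<Longrightarrow> smooth_open U (\<lambda>x. inverse (F x))"
  by (simp add: smooth_open_def times_differentiable_on_inverse)

lemma smooth_open_compose_linear:
  "open U \<Longrightarrow> bounded_linear L \<Longrightarrow> smooth_open U F \<Longrightarrow> smooth_open (L -` U) (\<lambda>x. F (L x))"
  by (simp add: smooth_open_def times_differentiable_on_compose_linear)

lemma smooth_open_ident: "open U \<Longrightarrow> smooth_open U (\<lambda>x. x)"
  unfolding smooth_open_def
proof
  fix k assume "open U"
  then show "times_differentiable_on k U (\<lambda>x. x)"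
  proof (cases k)
    case (Suc k)
    show ?thesis unfolding Suc
      by (rule times_differentiable_on_SucI[OF \<open>open U\<close>, of _ "\<lambda>x v. v"])
         (auto intro: times_differentiable_on_const has_derivative_ident)
  qed auto
qed

lemma smooth_open_subset:
  assumes "open U" "open V" "V \<subseteq> U" "smooth_open U F" shows "smooth_open V F"
proof -
  have "times_differentiable_on k U F \<Longrightarrow> times_differentiable_on k V F" for k
    using assms(3) by (induction k arbitrary: F) (auto intro: continuous_on_subset)
  then show ?thesis using assms(4) by (simp add: smooth_open_def)
qed

lemma smooth_open_imp_continuous_on: "smooth_open U F \<Longrightarrow> continuous_on U F"
  unfolding smooth_open_def by (drule spec[of _ 0]) simp

lemma smooth_mapE:
  assumes "smooth_map S h" "z \<in> S"
  obtains U F where "open U" "z \<in> U" "smooth_open U F" "\<forall>x\<in>U\<inter>S. F x = h x"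
proof -
  obtain U F where "open U \<and> z \<in> U \<and> smooth_open U F \<and> (\<forall>x\<in>U\<inter>S. F x = h x)"
    using assms(1)[unfolded smooth_map_def, THEN bspec, OF assms(2)] by (elim exE)
  then show thesis by (intro that[of U F]) simp_all
qed

lemma smooth_mapI:
  assumes "\<And>z. z \<in> S \<Longrightarrow> \<exists>U F. open U \<and> z \<in> U \<and> smooth_open U F \<and> (\<forall>x\<in>U\<inter>S. F x = h x)"
  shows "smooth_map S h"
  using assms by (simp add: smooth_map_def)

lemma smooth_map_cong: "smooth_map S h \<Longrightarrow> (\<And>x. x \<in> S \<Longrightarrow> h x = h' x) \<Longrightarrow> smooth_map S h'"
  by (simp add: smooth_map_def)

lemma smooth_map_const: "smooth_map S (\<lambda>x. c)"
  by (rule smooth_mapI) (auto intro!: exI[of _ UNIV] exI[of _ "\<lambda>x. c"] smooth_open_const)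

lemma smooth_map_ident: "smooth_map S (\<lambda>x. x)"
  by (rule smooth_mapI) (auto intro!: exI[of _ UNIV] exI[of _ "\<lambda>x. x"] smooth_open_ident)

lemma smooth_map_linear:
  assumes "bounded_linear L" "smooth_map S h" shows "smooth_map S (\<lambda>x. L (h x))"
proof (rule smooth_mapI)
  fix z assume "z \<in> S"
  obtain U F where F: "open U" "z \<in> U" "smooth_open U F" "\<forall>x\<in>U\<inter>S. F x = h x"
    by (rule smooth_mapE[OF assms(2) \<open>z \<in> S\<close>])
  then show "\<exists>U F. open U \<and> z \<in> U \<and> smooth_open U F \<and> (\<forall>x\<in>U\<inter>S. F x = L (h x))"
    using smooth_open_linear[OF F(1) assms(1) F(3)]
    by (intro exI[of _ U] exI[of _ "\<lambda>x. L (F x)"]) simp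
qed

lemma smooth_map_bilinear:
  assumes "bounded_bilinear P" "smooth_map S h" "smooth_map S k"
  shows "smooth_map S (\<lambda>x. P (h x) (k x))"
proof (rule smooth_mapI)
  fix z assume "z \<in> S"
  obtain U F where F: "open U" "z \<in> U" "smooth_open U F" "\<forall>x\<in>U\<inter>S. F x = h x"
    by (rule smooth_mapE[OF assms(2) \<open>z \<in> S\<close>])
  obtain V G where G: "open V" "z \<in> V" "smooth_open V G" "\<forall>x\<in>V\<inter>S. G x = k x"
    by (rule smooth_mapE[OF assms(3) \<open>z \<in> S\<close>])
  note o = open_Int[OF F(1) G(1)]
  have "smooth_open (U \<inter> V) (\<lambda>x. P (F x) (G x))"
    by (rule smooth_open_bilinear[OF o assms(1)
          smooth_open_subset[OF F(1) o Int_lower1 F(3)] smooth_open_subset[OF G(1) o Int_lower2 G(3)]])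
  then show "\<exists>U F. open U \<and> z \<in> U \<and> smooth_open U F \<and> (\<forall>x\<in>U\<inter>S. F x = P (h x) (k x))"
    using o F(2,4) G(2,4) by (intro exI[of _ "U \<inter> V"] exI[of _ "\<lambda>x. P (F x) (G x)"]) simp
qed

lemma smooth_map_add:
  assumes "smooth_map S h" "smooth_map S k" shows "smooth_map S (\<lambda>x. h x + k x)"
proof (rule smooth_mapI)
  fix z assume "z \<in> S"
  obtain U F where F: "open U" "z \<in> U" "smooth_open U F" "\<forall>x\<in>U\<inter>S. F x = h x"
    by (rule smooth_mapE[OF assms(1) \<open>z \<in> S\<close>])
  obtain V G where G: "open V" "z \<in> V" "smooth_open V G" "\<forall>x\<in>V\<inter>S. G x = k x"
    by (rule smooth_mapE[OF assms(2) \<open>z \<in> S\<close>])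
  note o = open_Int[OF F(1) G(1)]
  have "smooth_open (U \<inter> V) (\<lambda>x. F x + G x)"
    by (rule smooth_open_add[OF o
          smooth_open_subset[OF F(1) o Int_lower1 F(3)] smooth_open_subset[OF G(1) o Int_lower2 G(3)]])
  then show "\<exists>U F. open U \<and> z \<in> U \<and> smooth_open U F \<and> (\<forall>x\<in>U\<inter>S. F x = h x + k x)"
    using o F(2,4) G(2,4) by (intro exI[of _ "U \<inter> V"] exI[of _ "\<lambda>x. F x + G x"]) simp
qed

lemma smooth_map_diff:
  assumes "smooth_map S h" "smooth_map S k" shows "smooth_map S (\<lambda>x. h x - k x)"
  using smooth_map_add[OF assms(1) smooth_map_linear[OF bounded_linear_minus[OF bounded_linear_ident] assms(2)]]
  by simp

text \<open>A local extension may vanish off \<open>S\<close>, so its domain is cut down to where it does not.\<close>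

lemma smooth_map_inverse:
  fixes h :: "'a::euclidean_space \<Rightarrow> real"
  assumes "smooth_map S h" "\<And>x. x \<in> S \<Longrightarrow> h x \<noteq> 0"
  shows "smooth_map S (\<lambda>x. inverse (h x))"
proof (rule smooth_mapI)
  fix z assume "z \<in> S"
  obtain U F where F: "open U" "z \<in> U" "smooth_open U F" "\<forall>x\<in>U\<inter>S. F x = h x"
    by (rule smooth_mapE[OF assms(1) \<open>z \<in> S\<close>])
  define V where "V = U \<inter> F -` (- {0})"
  have V: "open V"
    unfolding V_def by (rule continuous_open_preimage[OF smooth_open_imp_continuous_on[OF F(3)] F(1)]) auto
  have "smooth_open V (\<lambda>x. inverse (F x))"
    by (rule smooth_open_inverse[OF V smooth_open_subset[OF F(1) V _ F(3)]]) (auto simp: V_def)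
  then show "\<exists>U G. open U \<and> z \<in> U \<and> smooth_open U G \<and> (\<forall>x\<in>U\<inter>S. G x = inverse (h x))"
    using F V \<open>z \<in> S\<close> assms(2)[of z]
    by (intro exI[of _ V] exI[of _ "\<lambda>x. inverse (F x)"]) (auto simp: V_def)
qed

lemma smooth_map_compose_linear:
  assumes "bounded_linear L" "smooth_map S h" "L ` S' \<subseteq> S"
  shows "smooth_map S' (\<lambda>x. h (L x))"
proof (rule smooth_mapI)
  fix z assume "z \<in> S'"
  then have "L z \<in> S" using assms(3) by auto
  obtain U F where F: "open U" "L z \<in> U" "smooth_open U F" "\<forall>x\<in>U\<inter>S. F x = h x"
    by (rule smooth_mapE[OF assms(2) \<open>L z \<in> S\<close>])
  have "open (L -` U)"
    using open_vimage[OF \<open>open U\<close>] assms(1) linear_continuous_on by blast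
  with F smooth_open_compose_linear[OF F(1) assms(1) F(3)] assms(3)
  show "\<exists>U F. open U \<and> z \<in> U \<and> smooth_open U F \<and> (\<forall>x\<in>U\<inter>S'. F x = h (L x))"
    by (intro exI[of _ "L -` U"] exI[of _ "\<lambda>x. F (L x)"]) auto
qed

lemma smooth_map_sum:
  assumes "\<And>i. i \<in> I \<Longrightarrow> smooth_map S (h i)"
  shows "smooth_map S (\<lambda>x. \<Sum>i\<in>I. h i x)"
  using assms by (induction I rule: infinite_finite_induct) (auto intro: smooth_map_const smooth_map_add)

lemma smooth_map_prod:
  fixes h :: "'i \<Rightarrow> 'a::euclidean_space \<Rightarrow> real"
  assumes "\<And>i. i \<in> I \<Longrightarrow> smooth_map S (h i)"
  shows "smooth_map S (\<lambda>x. \<Prod>i\<in>I. h i x)"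
  using assms
  by (induction I rule: infinite_finite_induct)
     (auto intro: smooth_map_const smooth_map_bilinear[OF bounded_bilinear_mult])

lemma smooth_map_vec_nth: "smooth_map S h \<Longrightarrow> smooth_map S (\<lambda>x. h x $ i)"
  by (rule smooth_map_linear[OF bounded_linear_vec_nth])

lemma smooth_map_vec_lambda:
  fixes h :: "'i::finite \<Rightarrow> 'a::euclidean_space \<Rightarrow> real"
  assumes "\<And>i. smooth_map S (h i)"
  shows "smooth_map S (\<lambda>x. \<chi> i. h i x)"
proof -
  have "smooth_map S (\<lambda>x. \<Sum>i\<in>UNIV. h i x *\<^sub>R (axis i 1 :: real^'i))"
    by (intro smooth_map_sum smooth_map_bilinear[OF bounded_bilinear_scaleR] assms smooth_map_const)
  moreover have "(\<Sum>i\<in>UNIV. h i x *\<^sub>R (axis i 1 :: real^'i)) = (\<chi> i. h i x)" for x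
    by (simp add: vec_eq_iff axis_def if_distrib cong: if_cong)
  ultimately show ?thesis by simp
qed

lemma smooth_map_det:
  fixes h :: "'i::finite \<Rightarrow> 'i \<Rightarrow> 'a::euclidean_space \<Rightarrow> real"
  assumes "\<And>i j. smooth_map S (h i j)"
  shows "smooth_map S (\<lambda>x. det (\<chi> i j. h i j x))"
  unfolding det_def
  by (simp, intro smooth_map_sum smooth_map_prod smooth_map_bilinear[OF bounded_bilinear_mult] smooth_map_const assms)

lemma matrix_inv_inverse:
  fixes A :: "real^'i^'i"
  assumes "invertible A" shows "A ** matrix_inv A = mat 1" "matrix_inv A ** A = mat 1"
  using someI_ex[OF assms[unfolded invertible_def]] by (auto simp: matrix_inv_def)

lemma spd_invertible: "spd A \<Longrightarrow> invertible A"
  unfolding spd_def invertible_left_inverse matrix_left_invertible_ker by force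

lemma spd_imp_det_nz: "spd A \<Longrightarrow> det A \<noteq> 0"
  using spd_invertible invertible_det_nz by blast

text \<open>Cramer's rule writes the solution of a linear system as quotients of determinants, which are
  polynomials in the entries.\<close>

lemma smooth_map_solve:
  fixes A :: "'a::euclidean_space \<Rightarrow> real^'i^'i"
  assumes "smooth_map S A" "smooth_map S b" "\<And>x. x \<in> S \<Longrightarrow> spd (A x)"
  shows "smooth_map S (\<lambda>x. matrix_inv (A x) *v b x)"
proof (rule smooth_map_cong)
  let ?s = "\<lambda>x. \<chi> k. det (\<chi> i j. if j = k then b x $ i else A x $ i $ j) * inverse (det (\<chi> i j. A x $ i $ j))"
  show "?s x = matrix_inv (A x) *v b x" if "x \<in> S" for x
  proof -
    have d: "det (A x) \<noteq> 0" using assms(3)[OF that] by (rule spd_imp_det_nz)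
    then have "invertible (A x)" by (simp add: invertible_det_nz)
    then have "A x *v (matrix_inv (A x) *v b x) = b x"
      by (simp add: matrix_vector_mul_assoc matrix_inv_inverse)
    then show ?thesis using cramer[OF d] by (simp add: divide_inverse)
  qed
  show "smooth_map S ?s"
  proof (intro smooth_map_vec_lambda smooth_map_bilinear[OF bounded_bilinear_mult] smooth_map_inverse smooth_map_det)
    show "smooth_map S (\<lambda>x. if j = k then b x $ i else A x $ i $ j)" for i j k
      by (cases "j = k") (simp_all add: smooth_map_vec_nth assms(1,2) smooth_map_vec_nth[OF smooth_map_vec_nth])
    show "smooth_map S (\<lambda>x. A x $ i $ j)" for i j
      by (rule smooth_map_vec_nth[OF smooth_map_vec_nth[OF assms(1)]])
    show "det (\<chi> i j. A x $ i $ j) \<noteq> 0" if "x \<in> S" for x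
      using spd_imp_det_nz[OF assms(3)[OF that]] by simp
  qed
qed

section \<open>Eigenvalues of quadratic forms and square roots\<close>

lemma symmetric_matrix_iff:
  fixes A :: "real^'n^'n"
  shows "transpose A = A \<longleftrightarrow> (\<forall>x y. x \<bullet> (A *v y) = y \<bullet> (A *v x))"
proof
  assume "transpose A = A"
  then show "\<forall>x y. x \<bullet> (A *v y) = y \<bullet> (A *v x)"
    by (metis dot_lmul_matrix inner_commute transpose_matrix_vector)
next
  assume r: "\<forall>x y. x \<bullet> (A *v y) = y \<bullet> (A *v x)"
  have "transpose A *v x = A *v x" for x
  proof (rule vector_eq_ldot[THEN iffD1], rule allI)
    fix y show "y \<bullet> (transpose A *v x) = y \<bullet> (A *v x)"
      using r by (metis dot_lmul_matrix inner_commute transpose_matrix_vector)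
  qed
  then show "transpose A = A" by (simp add: matrix_eq)
qed

lemma inner_transpose_mult:
  fixes G :: "real^'n^'m"
  shows "y \<bullet> (transpose G *v x) = x \<bullet> (G *v y)"
  by (simp add: dot_lmul_matrix inner_commute[of y])

text \<open>The first-order condition at a minimum: \<open>2 t b + t\<^sup>2 c\<close> is the increment of a quadratic form along
  a line through the minimiser.\<close>

lemma linear_coefficient_eq_0:
  fixes b c :: real
  assumes "\<And>t. 0 \<le> 2 * t * b + t\<^sup>2 * c"
  shows "b = 0"
proof (rule ccontr)
  assume "b \<noteq> 0"
  \<comment> \<open>Any positive \<open>d > c / 2\<close> makes the increment negative at \<open>t = - b / d\<close>.\<close>
  define d where "d = \<bar>c\<bar> + 1"
  have d: "d > 0" "c < 2 * d" by (auto simp: d_def)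
  have "0 \<le> (2 * (- b / d) * b + (- b / d)\<^sup>2 * c) * d\<^sup>2"
    by (rule mult_nonneg_nonneg[OF assms zero_le_power2])
  also have "\<dots> = b\<^sup>2 * (c - 2 * d)"
    using d by (simp add: field_simps power2_eq_square)
  also have "\<dots> < 0"
    using d \<open>b \<noteq> 0\<close> by (intro mult_pos_neg) auto
  finally show False by simp
qed

text \<open>The eigenvalues of the form \<open>K\<close> relative to the form \<open>M\<close> on \<open>T\<close>, in variational form. One notion
  covers the pencil \<open>(K, M)\<close> (\<open>T = UNIV\<close>), the ordinary eigenvalues of \<open>K\<close> on an invariant subspace
  (\<open>M = 1\<close>), and the Riemannian Hessian, which is known through its form on the tangent space.\<close>

definition weak_eigenvalues :: "(real^'n) set \<Rightarrow> real^'n^'n \<Rightarrow> real^'n^'n \<Rightarrow> real set" where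
  "weak_eigenvalues T K M =
    {\<mu>. \<exists>\<eta>\<in>T. \<eta> \<noteq> 0 \<and> (\<forall>\<xi>\<in>T. \<xi> \<bullet> (K *v \<eta>) = \<mu> * (\<xi> \<bullet> (M *v \<eta>)))}"

text \<open>The Rayleigh quotient attains its minimum on the unit sphere of \<open>T\<close> by compactness; the
  first-order condition there says that the minimiser is an eigenvector and the minimum its
  eigenvalue.\<close>

lemma weak_eigenvalue_lower_bound:
  assumes T: "subspace T" "T \<noteq> {0}" and K: "transpose K = K" and M: "spd M"
  obtains \<mu> where "\<mu> \<in> weak_eigenvalues T K M" "\<And>\<xi>. \<xi> \<in> T \<Longrightarrow> \<mu> * (\<xi> \<bullet> (M *v \<xi>)) \<le> \<xi> \<bullet> (K *v \<xi>)"
proof -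
  define q where "q \<xi> = (\<xi> \<bullet> (K *v \<xi>)) / (\<xi> \<bullet> (M *v \<xi>))" for \<xi>
  have Mpos: "\<xi> \<bullet> (M *v \<xi>) > 0" if "\<xi> \<noteq> 0" for \<xi> using M that by (simp add: spd_def)
  have Ms: "x \<bullet> (M *v y) = y \<bullet> (M *v x)" for x y using M symmetric_matrix_iff by (auto simp: spd_def)
  have Ks: "x \<bullet> (K *v y) = y \<bullet> (K *v x)" for x y using K symmetric_matrix_iff by auto
  let ?C = "sphere 0 1 \<inter> T"
  obtain w where w: "w \<in> T" "w \<noteq> 0" using T subspace_0 by blast
  have "compact ?C" using T(1) by (intro compact_Int_closed closed_subspace) auto
  moreover have "(1 / norm w) *\<^sub>R w \<in> ?C" using w subspace_scale[OF T(1) w(1)] by simp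
  moreover have "continuous_on ?C q"
  proof -
    have "\<xi> \<bullet> (M *v \<xi>) \<noteq> 0" if "\<xi> \<in> ?C" for \<xi>
    proof -
      have "\<xi> \<noteq> 0" using that by auto
      from Mpos[OF this] show ?thesis by simp
    qed
    then show ?thesis
      unfolding q_def
      by (intro continuous_intros linear_continuous_on matrix_vector_mul_bounded_linear) blast
  qed
  ultimately obtain \<eta> where \<eta>: "\<eta> \<in> ?C" and min: "\<And>\<xi>. \<xi> \<in> ?C \<Longrightarrow> q \<eta> \<le> q \<xi>"
    using continuous_attains_inf[of ?C q] by blast
  have \<eta>': "\<eta> \<in> T" "\<eta> \<noteq> 0" using \<eta> by auto
  have bound: "q \<eta> * (\<xi> \<bullet> (M *v \<xi>)) \<le> \<xi> \<bullet> (K *v \<xi>)" if "\<xi> \<in> T" for \<xi>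
  proof (cases "\<xi> = 0")
    case False
    have "q \<eta> \<le> q ((1 / norm \<xi>) *\<^sub>R \<xi>)"
      using False subspace_scale[OF T(1) that] by (intro min) simp
    also have "\<dots> = q \<xi>" using False by (simp add: q_def matrix_vector_mult_scaleR)
    finally show ?thesis using Mpos[OF False] by (simp add: q_def pos_le_divide_eq)
  qed simp
  have "\<xi> \<bullet> (K *v \<eta>) - q \<eta> * (\<xi> \<bullet> (M *v \<eta>)) = 0" if "\<xi> \<in> T" for \<xi>
  proof (rule linear_coefficient_eq_0)
    fix t
    have "\<eta> + t *\<^sub>R \<xi> \<in> T" using T(1) \<eta>' that by (simp add: subspace_add subspace_scale)
    from bound[OF this]
    have "0 \<le> (\<eta> \<bullet> (K *v \<eta>) - q \<eta> * (\<eta> \<bullet> (M *v \<eta>))) + 2 * t * (\<xi> \<bullet> (K *v \<eta>) - q \<eta> * (\<xi> \<bullet> (M *v \<eta>)))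
        + t\<^sup>2 * (\<xi> \<bullet> (K *v \<xi>) - q \<eta> * (\<xi> \<bullet> (M *v \<xi>)))"
      using Ms[of \<eta> \<xi>] Ks[of \<eta> \<xi>]
      by (simp add: matrix_vector_right_distrib matrix_vector_mult_scaleR inner_add_left inner_add_right
          power2_eq_square algebra_simps)
    moreover have "\<eta> \<bullet> (K *v \<eta>) - q \<eta> * (\<eta> \<bullet> (M *v \<eta>)) = 0"
      using Mpos[OF \<eta>'(2)] by (simp add: q_def)
    ultimately show "0 \<le> 2 * t * (\<xi> \<bullet> (K *v \<eta>) - q \<eta> * (\<xi> \<bullet> (M *v \<eta>)))
        + t\<^sup>2 * (\<xi> \<bullet> (K *v \<xi>) - q \<eta> * (\<xi> \<bullet> (M *v \<xi>)))" by simp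
  qed
  then have "q \<eta> \<in> weak_eigenvalues T K M" using \<eta>' by (auto simp: weak_eigenvalues_def)
  then show thesis using bound by (rule that)
qed

lemma matrix_vector_mult_minus_left: "(- A) *v x = - (A *v (x :: real^'n))"
  using matrix_vector_mult_diff_rdistrib[of 0 A x] by simp

lemma weak_eigenvalue_upper_bound:
  assumes T: "subspace T" "T \<noteq> {0}" and K: "transpose K = K" and M: "spd M"
  obtains \<mu> where "\<mu> \<in> weak_eigenvalues T K M" "\<And>\<xi>. \<xi> \<in> T \<Longrightarrow> \<xi> \<bullet> (K *v \<xi>) \<le> \<mu> * (\<xi> \<bullet> (M *v \<xi>))"
proof -
  have "transpose (- K) = - K" using K by (simp add: transpose_def vec_eq_iff)
  then obtain \<mu> where \<mu>: "\<mu> \<in> weak_eigenvalues T (- K) M"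
      "\<And>\<xi>. \<xi> \<in> T \<Longrightarrow> \<mu> * (\<xi> \<bullet> (M *v \<xi>)) \<le> \<xi> \<bullet> ((- K) *v \<xi>)"
    using weak_eigenvalue_lower_bound[OF T _ M] by blast
  show thesis
  proof (rule that[of "- \<mu>"])
    show "- \<mu> \<in> weak_eigenvalues T K M"
      using \<mu>(1) by (force simp: weak_eigenvalues_def matrix_vector_mult_minus_left)
    show "\<xi> \<bullet> (K *v \<xi>) \<le> - \<mu> * (\<xi> \<bullet> (M *v \<xi>))" if "\<xi> \<in> T" for \<xi>
      using \<mu>(2)[OF that] by (simp add: matrix_vector_mult_minus_left)
  qed
qed

lemma spd_mat_1: "spd (mat 1)"
  by (simp add: spd_def)

text \<open>If \<open>T\<close> is invariant, the residual \<open>A \<eta> - \<mu> \<eta>\<close> lies in \<open>T\<close> and is orthogonal to \<open>T\<close>.\<close>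

lemma weak_eigenvector_invariant:
  assumes "subspace T" "\<And>\<xi>. \<xi> \<in> T \<Longrightarrow> A *v \<xi> \<in> T" "\<mu> \<in> weak_eigenvalues T A (mat 1)"
  obtains \<eta> where "\<eta> \<in> T" "\<eta> \<noteq> 0" "A *v \<eta> = \<mu> *\<^sub>R \<eta>"
proof -
  obtain \<eta> where \<eta>: "\<eta> \<in> T" "\<eta> \<noteq> 0" and e: "\<And>\<xi>. \<xi> \<in> T \<Longrightarrow> \<xi> \<bullet> (A *v \<eta>) = \<mu> * (\<xi> \<bullet> \<eta>)"
    using assms(3) by (auto simp: weak_eigenvalues_def)
  let ?d = "A *v \<eta> - \<mu> *\<^sub>R \<eta>"
  have "?d \<in> T" using assms \<eta> by (simp add: subspace_diff subspace_scale)
  from e[OF this] have "?d \<bullet> ?d = 0" by (simp add: inner_diff_right)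
  then show thesis using that[OF \<eta>] by simp
qed

text \<open>Take an orthonormal set of eigenvectors of largest cardinality. If it did not span, its orthogonal
  complement would be a nonzero invariant subspace and contain one more eigenvector.\<close>

lemma symmetric_orthonormal_eigenbasis:
  fixes A :: "real^'n^'n"
  assumes A: "transpose A = A"
  obtains E where "finite E" "pairwise orthogonal E" "\<And>e. e \<in> E \<Longrightarrow> norm e = 1"
    "\<And>e. e \<in> E \<Longrightarrow> \<exists>l. A *v e = l *\<^sub>R e" "span E = UNIV"
proof -
  define P where "P E \<longleftrightarrow> pairwise orthogonal E \<and> (\<forall>e\<in>E. norm e = 1 \<and> (\<exists>l. A *v e = l *\<^sub>R e))" for E
  have bound: "finite E \<and> card E \<le> DIM(real^'n)" if "P E" for E
  proof (rule independent_bound, rule pairwise_orthogonal_independent)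
    show "pairwise orthogonal E" "0 \<notin> E" using that by (auto simp: P_def)
  qed
  have "P {}" by (simp add: P_def)
  moreover have "\<forall>E. P E \<longrightarrow> card E < Suc DIM(real^'n)" using bound by (simp add: less_Suc_eq_le)
  ultimately obtain E where E: "P E" and "\<forall>E'. P E' \<longrightarrow> card E' \<le> card E"
    using ex_has_greatest_nat[of P "{}" card "Suc DIM(real^'n)"] by metis
  then have max: "\<And>E'. P E' \<Longrightarrow> card E' \<le> card E" by simp
  have "span E = UNIV"
  proof (rule ccontr)
    assume "span E \<noteq> UNIV"
    then obtain a where a: "a \<noteq> 0" "\<forall>x\<in>span E. a \<bullet> x = 0"
      using span_not_UNIV_orthogonal by blast
    define T where "T = {x. \<forall>e\<in>E. e \<bullet> x = 0}"
    have "a \<in> T" using a(2) by (auto simp: T_def inner_commute span_base)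
    then have T: "subspace T" "T \<noteq> {0}"
      using a(1) by (auto simp: T_def subspace_def inner_add_right)
    have inv: "A *v x \<in> T" if "x \<in> T" for x
    proof -
      have "e \<bullet> (A *v x) = 0" if "e \<in> E" for e
      proof -
        obtain l where "A *v e = l *\<^sub>R e" using E \<open>e \<in> E\<close> unfolding P_def by blast
        moreover have "e \<bullet> (A *v x) = x \<bullet> (A *v e)" using A symmetric_matrix_iff by blast
        ultimately show ?thesis using \<open>x \<in> T\<close> \<open>e \<in> E\<close> by (auto simp: T_def inner_commute[of x e])
      qed
      then show ?thesis by (simp add: T_def)
    qed
    obtain \<mu> where \<mu>: "\<mu> \<in> weak_eigenvalues T A (mat 1)"
      by (rule weak_eigenvalue_lower_bound[OF T A spd_mat_1])
    obtain \<eta> where \<eta>: "\<eta> \<in> T" "\<eta> \<noteq> 0" "A *v \<eta> = \<mu> *\<^sub>R \<eta>"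
      by (rule weak_eigenvector_invariant[OF T(1) inv \<mu>])
    define e where "e = (1 / norm \<eta>) *\<^sub>R \<eta>"
    have e: "norm e = 1" "A *v e = \<mu> *\<^sub>R e" "e \<in> T"
      using \<eta> subspace_scale[OF T(1) \<eta>(1)] by (auto simp: e_def matrix_vector_mult_scaleR)
    have "e \<notin> E"
    proof
      assume "e \<in> E"
      then have "e \<bullet> e = 0" using e(3) by (simp add: T_def)
      then show False using e(1) by simp
    qed
    have "P (insert e E)"
      using E e by (auto simp: P_def pairwise_insert orthogonal_def T_def inner_commute)
    then have "card (insert e E) \<le> card E" by (rule max)
    then show False using bound[OF E] \<open>e \<notin> E\<close> by simp
  qed
  then show thesis using that[of E] bound[OF E] E by (auto simp: P_def)
qed

lemma spd_square_root_exists: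
  fixes C :: "real^'n^'n"
  assumes C: "spd C"
  obtains B where "spd B" "B ** B = C"
proof -
  have "transpose C = C" using C by (simp add: spd_def)
  then obtain E where E: "finite E" "pairwise orthogonal E" "\<And>e. e \<in> E \<Longrightarrow> norm e = 1"
    "\<And>e. e \<in> E \<Longrightarrow> \<exists>l. C *v e = l *\<^sub>R e" "span E = UNIV"
    by (rule symmetric_orthonormal_eigenbasis) (rule that)
  have "\<forall>e\<in>E. \<exists>l. C *v e = l *\<^sub>R e" using E(4) by simp
  then obtain l where "\<forall>e\<in>E. C *v e = l e *\<^sub>R e" by (rule bchoice[THEN exE])
  then have l: "\<And>e. e \<in> E \<Longrightarrow> C *v e = l e *\<^sub>R e" by simp
  have nz: "e \<noteq> 0" if "e \<in> E" for e using E(3)[OF that] by auto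
  have pos: "l e > 0" if "e \<in> E" for e
  proof -
    have "e \<bullet> (C *v e) > 0" using C nz[OF that] by (simp add: spd_def)
    then show ?thesis using l[OF that] E(3)[OF that] by (simp add: dot_square_norm)
  qed
  define L where "L x = (\<Sum>e\<in>E. (sqrt (l e) * (e \<bullet> x)) *\<^sub>R e)" for x
  have lin: "linear L"
    unfolding L_def
    by (rule linearI) (simp_all add: inner_add_right algebra_simps sum.distrib scaleR_sum_right)
  define B where "B = matrix L"
  have B: "B *v x = L x" for x unfolding B_def using fun_cong[OF matrix_vector_mul(2)[OF lin]] .
  have in_L: "x \<bullet> L y = (\<Sum>e\<in>E. sqrt (l e) * (e \<bullet> x) * (e \<bullet> y))" for x y
    by (simp add: L_def inner_sum_right inner_commute mult_ac)
  have "spd B"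
    unfolding spd_def
  proof (intro conjI allI impI)
    show "transpose B = B" by (simp add: symmetric_matrix_iff B in_L mult_ac)
    fix x :: "real^'n" assume "x \<noteq> 0"
    have "\<not> (\<forall>e\<in>E. e \<bullet> x = 0)"
    proof
      assume "\<forall>e\<in>E. e \<bullet> x = 0"
      then have "(\<Sum>e\<in>E. (x \<bullet> e) *\<^sub>R e) = 0" by (simp add: inner_commute)
      moreover have "(\<Sum>e\<in>E. (x \<bullet> e) *\<^sub>R e) = x"
        using E by (intro orthonormal_basis_expand) auto
      ultimately show False using \<open>x \<noteq> 0\<close> by simp
    qed
    then obtain e where e: "e \<in> E" "e \<bullet> x \<noteq> 0" by blast
    have "0 < (\<Sum>e\<in>E. sqrt (l e) * (e \<bullet> x)\<^sup>2)"
    proof (rule sum_pos2[OF E(1) e(1)])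
      show "0 < sqrt (l e) * (e \<bullet> x)\<^sup>2" using pos[OF e(1)] e(2) by simp
      show "0 \<le> sqrt (l i) * (i \<bullet> x)\<^sup>2" if "i \<in> E" for i using pos[OF that] by simp
    qed
    then show "0 < x \<bullet> (B *v x)" by (simp add: B in_L power2_eq_square mult.assoc)
  qed
  moreover have "B ** B = C"
  proof -
    have Le: "L e = sqrt (l e) *\<^sub>R e" if "e \<in> E" for e
    proof -
      have "L e = (\<Sum>e'\<in>E. if e' = e then sqrt (l e) *\<^sub>R e else 0)"
        unfolding L_def
      proof (rule sum.cong[OF refl])
        fix e' assume "e' \<in> E"
        then show "(sqrt (l e') * (e' \<bullet> e)) *\<^sub>R e' = (if e' = e then sqrt (l e) *\<^sub>R e else 0)"
          using E(2) E(3)[OF that] that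
          by (auto simp: pairwise_def orthogonal_def dot_square_norm)
      qed
      then show ?thesis using E(1) that by simp
    qed
    have "(B ** B) *v x = C *v x" for x
    proof (rule linear_eq_on_span[of "\<lambda>x. (B ** B) *v x" "\<lambda>x. C *v x" E x])
      show "(B ** B) *v e = C *v e" if "e \<in> E" for e
        using that pos[OF that] l[OF that]
        by (simp add: matrix_vector_mul_assoc[symmetric] B Le linear_scale[OF lin])
    qed (use E(5) in auto)
    then show ?thesis by (simp add: matrix_eq)
  qed
  ultimately show thesis by (rule that)
qed

lemma spd_symD: "spd A \<Longrightarrow> x \<bullet> (A *v y) = y \<bullet> (A *v x)"
  using symmetric_matrix_iff by (auto simp: spd_def)

lemma spd_posD: "spd A \<Longrightarrow> x \<noteq> 0 \<Longrightarrow> x \<bullet> (A *v x) > 0"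
  by (simp add: spd_def)

text \<open>For \<open>D = B - B'\<close> the equation \<open>B\<^sup>2 = B'\<^sup>2\<close> reads \<open>B D + D B' = 0\<close>. Pairing with an eigenvector \<open>x\<close>
  of \<open>D\<close> gives \<open>\<mu> (x\<^sup>T B x + x\<^sup>T B' x) = 0\<close>, so every eigenvalue of \<open>D\<close>, and hence \<open>D\<close>, is zero.\<close>

lemma spd_square_root_unique:
  fixes B :: "real^'n^'n"
  assumes B: "spd B" "spd B'" "B ** B = B' ** B'"
  shows "B = B'"
proof -
  define D where "D = B - B'"
  have D: "transpose D = D" using B by (simp add: D_def spd_def transpose_def vec_eq_iff)
  have sq: "B *v (B *v x) = B' *v (B' *v x)" for x
    using B(3) by (simp add: matrix_vector_mul_assoc)
  have zero: "\<mu> = 0" if \<mu>: "\<mu> \<in> weak_eigenvalues UNIV D (mat 1)" for \<mu>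
  proof -
    obtain x where x: "x \<noteq> 0" "D *v x = \<mu> *\<^sub>R x"
      using weak_eigenvector_invariant[OF subspace_UNIV _ \<mu>] by auto
    have "B *v x = B' *v x + \<mu> *\<^sub>R x"
      using x(2) by (simp add: D_def matrix_vector_mult_diff_rdistrib algebra_simps)
    then have "x \<bullet> (B *v (B *v x)) = x \<bullet> (B *v (B' *v x)) + \<mu> * (x \<bullet> (B *v x))"
      "(B' *v x) \<bullet> (B *v x) = (B' *v x) \<bullet> (B' *v x) + \<mu> * (x \<bullet> (B' *v x))"
      by (simp_all add: matrix_vector_right_distrib matrix_vector_mult_scaleR inner_add_right inner_commute)
    moreover have "x \<bullet> (B *v (B' *v x)) = (B' *v x) \<bullet> (B *v x)" by (rule spd_symD[OF B(1)])
    moreover have "x \<bullet> (B' *v (B' *v x)) = (B' *v x) \<bullet> (B' *v x)" by (rule spd_symD[OF B(2)])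
    ultimately have "\<mu> * (x \<bullet> (B *v x) + x \<bullet> (B' *v x)) = 0"
      using sq[of x] by (simp add: algebra_simps)
    moreover have "x \<bullet> (B *v x) + x \<bullet> (B' *v x) > 0"
      using spd_posD[OF B(1) x(1)] spd_posD[OF B(2) x(1)] by simp
    ultimately show ?thesis by simp
  qed
  have U: "(UNIV :: (real^'n) set) \<noteq> {0}"
    by (metis UNIV_I singletonD zero_neq_one)
  obtain \<mu> where "\<mu> \<in> weak_eigenvalues UNIV D (mat 1)"
      and lower: "\<And>x. x \<in> UNIV \<Longrightarrow> \<mu> * (x \<bullet> (mat 1 *v x)) \<le> x \<bullet> (D *v x)"
    by (rule weak_eigenvalue_lower_bound[OF subspace_UNIV U D spd_mat_1]) (rule that)
  moreover obtain \<nu> where "\<nu> \<in> weak_eigenvalues UNIV D (mat 1)"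
      and upper: "\<And>x. x \<in> UNIV \<Longrightarrow> x \<bullet> (D *v x) \<le> \<nu> * (x \<bullet> (mat 1 *v x))"
    by (rule weak_eigenvalue_upper_bound[OF subspace_UNIV U D spd_mat_1]) (rule that)
  ultimately have "\<mu> = 0" "\<nu> = 0" using zero by auto
  then have form: "x \<bullet> (D *v x) = 0" for x
    using lower[of x] upper[of x] by simp
  have "x \<bullet> (D *v y) = 0" for x y
    using form[of "x + y"] form[of x] form[of y] D[unfolded symmetric_matrix_iff, rule_format, of x y]
    by (simp add: matrix_vector_right_distrib inner_add_left inner_add_right)
  then have "D *v y = 0" for y by (metis inner_eq_zero_iff)
  then have "D = 0" by (simp add: matrix_eq)
  then show ?thesis by (simp add: D_def)
qed

lemma spd_sqrt:
  assumes "spd C" shows "spd (spd_sqrt C)" "spd_sqrt C ** spd_sqrt C = C"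
proof -
  obtain B where B: "spd B" "B ** B = C" using spd_square_root_exists[OF assms] .
  have "spd (spd_sqrt C) \<and> spd_sqrt C ** spd_sqrt C = C"
    unfolding spd_sqrt_def
    by (rule theI[of _ B]) (use B spd_square_root_unique in auto)
  then show "spd (spd_sqrt C)" "spd_sqrt C ** spd_sqrt C = C" by auto
qed

lemma inv_sqrt:
  fixes C :: "real^'n^'n"
  assumes "spd C"
  shows "spd_sqrt C *v (inv_sqrt C *v x) = x" "inv_sqrt C *v (spd_sqrt C *v x) = x"
    "(inv_sqrt C *v x) \<bullet> y = x \<bullet> (inv_sqrt C *v y)"
    "(inv_sqrt C *v x) \<bullet> (C *v (inv_sqrt C *v y)) = x \<bullet> y"
proof -
  note s = spd_sqrt[OF assms]
  show 1: "spd_sqrt C *v (inv_sqrt C *v x) = x" "inv_sqrt C *v (spd_sqrt C *v x) = x" for x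
    using matrix_inv_inverse[OF spd_invertible[OF s(1)]]
    by (simp_all add: inv_sqrt_def matrix_vector_mul_assoc)
  show 2: "(inv_sqrt C *v x) \<bullet> y = x \<bullet> (inv_sqrt C *v y)" for x y
    using spd_symD[OF s(1), of "inv_sqrt C *v x" "inv_sqrt C *v y"] by (simp add: 1 inner_commute)
  have "C *v z = spd_sqrt C *v (spd_sqrt C *v z)" for z
    using s(2) by (simp add: matrix_vector_mul_assoc)
  then show "(inv_sqrt C *v x) \<bullet> (C *v (inv_sqrt C *v y)) = x \<bullet> y"
    by (simp add: 1 2)
qed

text \<open>Eigenvectors of different eigenvalues are orthogonal for \<open>M\<close>; the square root of \<open>M\<close> carries them
  to nonzero vectors that are orthogonal in the usual sense, hence independent.\<close>

lemma finite_weak_eigenvalues: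
  fixes K M :: "real^'n^'n"
  assumes K: "transpose K = K" and M: "spd M"
  shows "finite (weak_eigenvalues T K M)"
proof -
  have "\<forall>\<mu>\<in>weak_eigenvalues T K M. \<exists>\<eta>. \<eta> \<in> T \<and> \<eta> \<noteq> 0 \<and> (\<forall>\<xi>\<in>T. \<xi> \<bullet> (K *v \<eta>) = \<mu> * (\<xi> \<bullet> (M *v \<eta>)))"
    by (auto simp: weak_eigenvalues_def)
  then obtain e where e: "\<And>\<mu>. \<mu> \<in> weak_eigenvalues T K M \<Longrightarrow> e \<mu> \<in> T \<and> e \<mu> \<noteq> 0"
      "\<And>\<mu> \<xi>. \<mu> \<in> weak_eigenvalues T K M \<Longrightarrow> \<xi> \<in> T \<Longrightarrow> \<xi> \<bullet> (K *v e \<mu>) = \<mu> * (\<xi> \<bullet> (M *v e \<mu>))"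
    by metis
  define B where "B = spd_sqrt M"
  have B: "spd B" "B ** B = M" using spd_sqrt[OF M] by (auto simp: B_def)
  have BM: "(B *v x) \<bullet> (B *v y) = x \<bullet> (M *v y)" for x y
    using spd_symD[OF B(1), of "B *v y" x] B(2) by (simp add: matrix_vector_mul_assoc inner_commute)
  have orth: "(B *v e \<mu>) \<bullet> (B *v e \<nu>) = 0"
    if "\<mu> \<in> weak_eigenvalues T K M" "\<nu> \<in> weak_eigenvalues T K M" "\<mu> \<noteq> \<nu>" for \<mu> \<nu>
  proof -
    have "e \<nu> \<bullet> (K *v e \<mu>) = e \<mu> \<bullet> (K *v e \<nu>)" using K symmetric_matrix_iff by blast
    then have "\<mu> * (e \<nu> \<bullet> (M *v e \<mu>)) = \<nu> * (e \<mu> \<bullet> (M *v e \<nu>))" using e that by simp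
    with spd_symD[OF M, of "e \<nu>" "e \<mu>"] that(3) show ?thesis by (simp add: BM)
  qed
  have nz: "B *v e \<mu> \<noteq> 0" if "\<mu> \<in> weak_eigenvalues T K M" for \<mu>
    using BM[of "e \<mu>" "e \<mu>"] spd_posD[OF M, of "e \<mu>"] e(1)[OF that] by auto
  let ?E = "(\<lambda>\<mu>. B *v e \<mu>) ` weak_eigenvalues T K M"
  have "independent ?E"
  proof (rule pairwise_orthogonal_independent)
    show "0 \<notin> ?E" using nz by force
    show "pairwise orthogonal ?E"
      unfolding pairwise_image by (auto simp: pairwise_def orthogonal_def orth)
  qed
  then have "finite ?E" by (rule independent_imp_finite)
  moreover have "inj_on (\<lambda>\<mu>. B *v e \<mu>) (weak_eigenvalues T K M)"
  proof (rule inj_onI, rule ccontr)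
    fix \<mu> \<nu> assume a: "\<mu> \<in> weak_eigenvalues T K M" "\<nu> \<in> weak_eigenvalues T K M"
      "B *v e \<mu> = B *v e \<nu>" "\<mu> \<noteq> \<nu>"
    from orth[OF a(1,2,4)] a(3) nz[OF a(2)] show False by simp
  qed
  ultimately show ?thesis by (rule finite_imageD)
qed

section \<open>Condition numbers of pencils\<close>

lemma abs_ratio_le:
  assumes E: "finite E" "E \<noteq> {}" "E \<subseteq> {lo..hi}" and lo: "0 < lo"
  shows "abs_ratio E \<le> hi / lo"
  unfolding abs_ratio_def
proof (rule frac_le)
  have "\<bar>x\<bar> \<le> hi \<and> lo \<le> \<bar>x\<bar>" if "x \<in> E" for x using E(3) lo that by auto
  then show "Max (abs ` E) \<le> hi" "lo \<le> Min (abs ` E)" using E(1,2) by auto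
  obtain x where "x \<in> E" using E(2) by blast
  with E(3) lo show "0 \<le> hi" by force
qed (rule lo)

lemma abs_ratio_ge:
  assumes E: "finite E" "lo \<in> E" "hi \<in> E" "E \<subseteq> {0<..}"
  shows "hi / lo \<le> abs_ratio E"
  unfolding abs_ratio_def
proof (rule frac_le)
  have pos: "0 < lo" "0 < hi" using E by auto
  then show "hi \<le> Max (abs ` E)" using E(1,3) by (intro Max_ge) (auto intro!: image_eqI[of _ _ hi])
  then show "0 \<le> Max (abs ` E)" using pos by simp
  show "Min (abs ` E) \<le> lo" using E(1,2) pos by (intro Min_le) (auto intro!: image_eqI[of _ _ lo])
  show "0 < Min (abs ` E)" using E by (subst Min_gr_iff) auto
qed

lemma pencil_eigenvalues_weak: "pencil_eigenvalues K M = weak_eigenvalues UNIV K M"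
proof -
  have "K *v v = \<mu> *\<^sub>R (M *v v) \<longleftrightarrow> (\<forall>\<xi>. \<xi> \<bullet> (K *v v) = \<mu> * (\<xi> \<bullet> (M *v v)))" for \<mu> v
    using vector_eq_ldot[of "K *v v" "\<mu> *\<^sub>R (M *v v)"] by simp
  then show ?thesis by (auto simp: pencil_eigenvalues_def weak_eigenvalues_def)
qed

lemma weak_eigenvalue_rayleigh:
  assumes "\<mu> \<in> weak_eigenvalues T K M"
  obtains \<eta> where "\<eta> \<in> T" "\<eta> \<noteq> 0" "\<eta> \<bullet> (K *v \<eta>) = \<mu> * (\<eta> \<bullet> (M *v \<eta>))"
  using assms by (auto simp: weak_eigenvalues_def)

text \<open>The quotient of \<open>K\<close> by \<open>M\<close> is the quotient of \<open>K\<close> by \<open>Sig\<close>, which lies in \<open>[lo, hi]\<close> on \<open>T\<close>, times the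
  quotient of \<open>Sig\<close> by \<open>M\<close>, which lies between the extreme generalized eigenvalues \<open>p\<close> and \<open>q\<close>.\<close>

lemma preconditioned_eigenvalue_bounds:
  assumes T: "subspace T" and Sig: "spd Sig" and M: "spd M" and K: "transpose K = K"
    and lo: "0 < lo" "\<And>\<xi>. \<xi> \<in> T \<Longrightarrow> lo * (\<xi> \<bullet> (Sig *v \<xi>)) \<le> \<xi> \<bullet> (K *v \<xi>)"
    and hi: "0 \<le> hi" "\<And>\<xi>. \<xi> \<in> T \<Longrightarrow> \<xi> \<bullet> (K *v \<xi>) \<le> hi * (\<xi> \<bullet> (Sig *v \<xi>))"
    and T0: "T \<noteq> {0}"
  shows "abs_ratio (weak_eigenvalues T K M) \<le> hi / lo * pencil_cond Sig M"
proof -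
  have Ssym: "transpose Sig = Sig" using Sig by (simp add: spd_def)
  have U: "(UNIV :: (real^'a) set) \<noteq> {0}" by (metis UNIV_I singletonD zero_neq_one)
  let ?P = "weak_eigenvalues UNIV Sig M"
  obtain p where p: "p \<in> ?P" "\<And>\<xi>. \<xi> \<in> UNIV \<Longrightarrow> p * (\<xi> \<bullet> (M *v \<xi>)) \<le> \<xi> \<bullet> (Sig *v \<xi>)"
    by (rule weak_eigenvalue_lower_bound[OF subspace_UNIV U Ssym M]) (rule that)
  obtain q where q: "q \<in> ?P" "\<And>\<xi>. \<xi> \<in> UNIV \<Longrightarrow> \<xi> \<bullet> (Sig *v \<xi>) \<le> q * (\<xi> \<bullet> (M *v \<xi>))"
    by (rule weak_eigenvalue_upper_bound[OF subspace_UNIV U Ssym M]) (rule that)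
  have P_pos: "0 < \<mu>" if \<mu>: "\<mu> \<in> ?P" for \<mu>
  proof -
    obtain \<eta> where "\<eta> \<noteq> 0" "\<eta> \<bullet> (Sig *v \<eta>) = \<mu> * (\<eta> \<bullet> (M *v \<eta>))"
      by (rule weak_eigenvalue_rayleigh[OF \<mu>])
    with spd_posD[OF Sig] spd_posD[OF M] show ?thesis by (metis zero_less_mult_pos2)
  qed
  have "weak_eigenvalues T K M \<subseteq> {lo * p..hi * q}"
  proof
    fix \<mu> assume "\<mu> \<in> weak_eigenvalues T K M"
    then obtain \<eta> where \<eta>: "\<eta> \<in> T" "\<eta> \<noteq> 0" "\<eta> \<bullet> (K *v \<eta>) = \<mu> * (\<eta> \<bullet> (M *v \<eta>))"
      by (rule weak_eigenvalue_rayleigh)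
    have m: "0 < \<eta> \<bullet> (M *v \<eta>)" by (rule spd_posD[OF M \<eta>(2)])
    have "lo * (p * (\<eta> \<bullet> (M *v \<eta>))) \<le> lo * (\<eta> \<bullet> (Sig *v \<eta>))"
      using p(2)[of \<eta>] lo(1) by (intro mult_left_mono) auto
    also have "\<dots> \<le> \<mu> * (\<eta> \<bullet> (M *v \<eta>))" using lo(2)[OF \<eta>(1)] \<eta>(3) by simp
    finally have "lo * p \<le> \<mu>" using m by simp
    have "\<mu> * (\<eta> \<bullet> (M *v \<eta>)) \<le> hi * (\<eta> \<bullet> (Sig *v \<eta>))" using hi(2)[OF \<eta>(1)] \<eta>(3) by simp
    also have "\<dots> \<le> hi * (q * (\<eta> \<bullet> (M *v \<eta>)))"
      using q(2)[of \<eta>] hi(1) by (intro mult_left_mono) auto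
    finally have "\<mu> \<le> hi * q" using m by simp
    with \<open>lo * p \<le> \<mu>\<close> show "\<mu> \<in> {lo * p..hi * q}" by simp
  qed
  moreover obtain \<nu> where "\<nu> \<in> weak_eigenvalues T K M"
    by (rule weak_eigenvalue_lower_bound[OF T T0 K M])
  ultimately have "abs_ratio (weak_eigenvalues T K M) \<le> (hi * q) / (lo * p)"
    using lo(1) P_pos[OF p(1)] by (intro abs_ratio_le finite_weak_eigenvalues K M) auto
  also have "\<dots> = hi / lo * (q / p)" by simp
  also have "\<dots> \<le> hi / lo * abs_ratio ?P"
    using hi(1) lo(1) P_pos p(1) q(1) finite_weak_eigenvalues[OF Ssym M]
    by (intro mult_left_mono abs_ratio_ge) auto
  finally show ?thesis by (simp add: pencil_cond_def pencil_eigenvalues_weak)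
qed

lemma pencil_cond_self:
  assumes "spd A" shows "pencil_cond A A = 1"
proof -
  have "pencil_eigenvalues A A = {1}"
  proof (intro equalityI subsetI)
    fix \<mu> assume "\<mu> \<in> pencil_eigenvalues A A"
    then obtain v where "v \<noteq> 0" "A *v v = \<mu> *\<^sub>R (A *v v)" by (auto simp: pencil_eigenvalues_def)
    then have "v \<bullet> (A *v v) = \<mu> * (v \<bullet> (A *v v))" by (metis inner_scaleR_right)
    with spd_posD[OF assms \<open>v \<noteq> 0\<close>] show "\<mu> \<in> {1}" by simp
  next
    fix \<mu> :: real assume "\<mu> \<in> {1}"
    then show "\<mu> \<in> pencil_eigenvalues A A"
      by (auto simp: pencil_eigenvalues_def intro!: exI[of _ 1])
  qed
  then show ?thesis by (simp add: pencil_cond_def abs_ratio_def)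
qed

section \<open>The second singular value\<close>

lemma inner_gram:
  fixes A :: "real^'n^'m"
  shows "x \<bullet> ((transpose A ** A) *v y) = (A *v x) \<bullet> (A *v y)"
  by (simp only: matrix_vector_mul_assoc[symmetric] inner_transpose_mult inner_commute[of "A *v y"])

lemma transpose_gram: "transpose (transpose A ** A) = transpose A ** A"
  for A :: "real^'n^'m"
  by (simp add: symmetric_matrix_iff inner_gram inner_commute)

lemma mem_singular_space: "v \<in> singular_space A s \<longleftrightarrow> (transpose A ** A) *v v = s\<^sup>2 *\<^sub>R v"
  by (simp only: singular_space_def mem_Collect_eq matrix_vector_mul_assoc)

lemma subspace_singular_space: "subspace (singular_space A s)"
  by (auto simp: subspace_def mem_singular_space matrix_vector_right_distrib matrix_vector_mult_scaleR
      algebra_simps)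

lemma finite_singular_value_set: "finite {s. 0 \<le> s \<and> singular_space A s \<noteq> {0}}"
proof (rule finite_subset)
  let ?W = "weak_eigenvalues UNIV (transpose A ** A) (mat 1)"
  show "finite (sqrt ` ?W)"
    by (rule finite_imageI[OF finite_weak_eigenvalues[OF transpose_gram spd_mat_1]])
  show "{s. 0 \<le> s \<and> singular_space A s \<noteq> {0}} \<subseteq> sqrt ` ?W"
  proof
    fix s assume "s \<in> {s. 0 \<le> s \<and> singular_space A s \<noteq> {0}}"
    then have s: "0 \<le> s" "singular_space A s \<noteq> {0}" by auto
    then obtain v where "v \<in> singular_space A s" "v \<noteq> 0"
      using subspace_0[OF subspace_singular_space] by blast
    then have "s\<^sup>2 \<in> ?W" by (auto simp: weak_eigenvalues_def mem_singular_space)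
    moreover have "s = sqrt (s\<^sup>2)" using s by simp
    ultimately show "s \<in> sqrt ` ?W" by blast
  qed
qed

lemma count_singular_values:
  "count (singular_values A) s = (if 0 \<le> s then dim (singular_space A s) else 0)"
proof -
  let ?I = "{s. 0 \<le> s \<and> singular_space A s \<noteq> {0}}"
  have "count (singular_values A) s = (\<Sum>t\<in>?I. if t = s then dim (singular_space A s) else 0)"
    unfolding singular_values_def count_sum by (rule sum.cong) auto
  also have "\<dots> = (if s \<in> ?I then dim (singular_space A s) else 0)"
    using finite_singular_value_set[of A] by simp
  also have "\<dots> = (if 0 \<le> s then dim (singular_space A s) else 0)"
    by auto
  finally show ?thesis .
qed

lemma singular_value_cases:
  "singular_value A i = 0 \<or> singular_value A i \<in># singular_values A"
proof -
  let ?L = "rev (sorted_list_of_multiset (singular_values A))"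
  have "?L ! (i - 1) \<in># singular_values A" if "1 \<le> i" "i \<le> length ?L"
  proof -
    have "?L ! (i - 1) \<in> set ?L" using that by (intro nth_mem) simp
    then show ?thesis by simp
  qed
  then show ?thesis by (auto simp: singular_value_def Let_def)
qed

lemma singular_value_nonneg: "0 \<le> singular_value A i"
  using singular_value_cases[of A i] count_singular_values[of A "singular_value A i"]
  by (auto simp: count_eq_zero_iff split: if_splits)

lemma singular_value_vector:
  assumes "singular_value A i > 0"
  obtains v where "v \<noteq> 0" "(transpose A ** A) *v v = (singular_value A i)\<^sup>2 *\<^sub>R v"
proof -
  have "singular_value A i \<in># singular_values A" using singular_value_cases[of A i] assms by auto
  then have "count (singular_values A) (singular_value A i) \<noteq> 0" by simp
  moreover have "count (singular_values A) (singular_value A i) = dim (singular_space A (singular_value A i))"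
    using assms by (simp add: count_singular_values)
  ultimately have "dim (singular_space A (singular_value A i)) \<noteq> 0" by (simp only: not_False_eq_True)
  then have "\<not> singular_space A (singular_value A i) \<subseteq> {0}" by (simp only: dim_eq_0 not_False_eq_True)
  then obtain v where "v \<in> singular_space A (singular_value A i)" "v \<noteq> 0" by blast
  then show thesis using that[of v] by (simp add: mem_singular_space)
qed

text \<open>Only one of two listed elements can occupy the first place of the decreasing list.\<close>

lemma second_largest_ge:
  fixes s t :: "'a::linorder"
  assumes xs: "sorted xs" and st: "{#s, t#} \<subseteq># mset xs"
  shows "2 \<le> length xs \<and> min s t \<le> rev xs ! 1"
proof -
  have len: "2 \<le> length xs" using size_mset_mono[OF st] by simp
  then obtain x y zs where r: "rev xs = x # y # zs"
    by (metis Suc_le_length_iff length_rev numeral_2_eq_2)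
  have "sorted (rev (x # y # zs))" using xs by (simp add: r[symmetric])
  then have y: "z \<le> y" if "z \<in> set (y # zs)" for z
    using that by (auto simp: sorted_append)
  have "mset xs = add_mset x (mset (y # zs))"
    by (metis mset.simps(2) mset_rev r)
  with st have st': "{#s, t#} \<subseteq># add_mset x (mset (y # zs))" by simp
  have "s \<in> set (y # zs) \<or> t \<in> set (y # zs)"
  proof (rule ccontr)
    define Z where "Z = mset (y # zs)"
    assume "\<not> ?thesis"
    then have n: "count Z s = 0" "count Z t = 0"
      by (auto simp: count_eq_zero_iff Z_def)
    have "{#s, t#} \<subseteq># add_mset x Z" using st' by (simp only: Z_def)
    then have "count {#s, t#} s \<le> count (add_mset x Z) s" "count {#s, t#} t \<le> count (add_mset x Z) t"
      by (simp_all only: mset_subset_eq_count)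
    with n show False by (auto split: if_splits)
  qed
  then have "min s t \<le> y" using y by (auto intro: min.coboundedI1 min.coboundedI2)
  with len r show ?thesis by simp
qed

text \<open>Orthogonality of \<open>v\<close> and \<open>w\<close> secures multiplicity two when \<open>s = t\<close>, so in every case \<open>s\<close> and \<open>t\<close> occur
  together among the singular values.\<close>

lemma second_singular_value_ge:
  fixes v w :: "real^'n" and A :: "real^'n^'m"
  assumes v: "v \<noteq> 0" "(transpose A ** A) *v v = s\<^sup>2 *\<^sub>R v" "0 \<le> s"
    and w: "w \<noteq> 0" "(transpose A ** A) *v w = t\<^sup>2 *\<^sub>R w" "0 \<le> t"
    and vw: "v \<bullet> w = 0"
  shows "min s t \<le> singular_value A 2"
proof -
  have vs: "v \<in> singular_space A s" and wt: "w \<in> singular_space A t"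
    using v w by (simp_all add: mem_singular_space)
  have pos: "1 \<le> dim (singular_space A s)" "1 \<le> dim (singular_space A t)"
    using vs wt v(1) w(1) dim_eq_0 by (metis One_nat_def Suc_leI neq0_conv singletonD subsetD)+
  have "{#s, t#} \<subseteq># singular_values A"
  proof (rule mset_subset_eqI)
    fix r
    have "2 \<le> dim (singular_space A s)" if "s = t"
    proof -
      have "v \<noteq> w" using vw v(1) by auto
      have "independent {v, w}"
        by (rule pairwise_orthogonal_independent)
           (use vw v(1) w(1) in \<open>auto simp: pairwise_def orthogonal_def inner_commute\<close>)
      moreover have "{v, w} \<subseteq> singular_space A s" using vs wt that by simp
      ultimately have "card {v, w} \<le> dim (singular_space A s)" by (rule independent_card_le_dim[rotated])
      then show ?thesis using \<open>v \<noteq> w\<close> by simp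
    qed
    then show "count {#s, t#} r \<le> count (singular_values A) r"
      using pos v(3) w(3) by (auto simp: count_singular_values)
  qed
  then have "{#s, t#} \<subseteq># mset (sorted_list_of_multiset (singular_values A))" by simp
  from second_largest_ge[OF _ this] show ?thesis
    by (simp add: singular_value_def Let_def)
qed

text \<open>The complement of \<open>\<psi>\<close> is invariant under \<open>R\<^sup>T R\<close>, so the square of the norm of \<open>R\<close> there is an
  eigenvalue \<open>\<mu>\<close> with an eigenvector orthogonal to \<open>\<psi>\<close>. Then \<open>s\<close> and \<open>sqrt \<mu>\<close> are two singular values,
  and as \<open>s\<close> exceeds the second one, \<open>sqrt \<mu>\<close> does not.\<close>

lemma operator_bound_orthogonal:
  fixes R :: "real^'n^'m"
  assumes uv: "unit_singular_vectors R s \<phi> \<psi>" and gap: "singular_value R 2 < s"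
    and b: "\<psi> \<bullet> b = 0"
  shows "norm (R *v b) \<le> singular_value R 2 * norm b"
proof -
  let ?N = "transpose R ** R" and ?T = "{b. \<psi> \<bullet> b = 0}"
  have s: "0 \<le> s" using gap singular_value_nonneg[of R 2] by simp
  have \<psi>: "?N *v \<psi> = s\<^sup>2 *\<^sub>R \<psi>" "\<psi> \<noteq> 0"
    using uv by (auto simp: unit_singular_vectors_def matrix_vector_mul_assoc[symmetric]
        matrix_vector_mult_scaleR power2_eq_square simp del: transpose_matrix_vector)
  show ?thesis
  proof (cases "?T = {0}")
    case True
    then have "b = 0" using b by blast
    then show ?thesis by simp
  next
    case False
    have T: "subspace ?T" by (auto simp: subspace_def inner_add_right)
    have inv: "?N *v x \<in> ?T" if "x \<in> ?T" for x
    proof -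
      have "\<psi> \<bullet> (?N *v x) = x \<bullet> (?N *v \<psi>)" by (simp add: inner_gram inner_commute)
      then show ?thesis using that \<psi>(1) by (simp add: inner_commute)
    qed
    obtain \<mu> where \<mu>: "\<mu> \<in> weak_eigenvalues ?T ?N (mat 1)"
      and ub: "\<And>x. x \<in> ?T \<Longrightarrow> x \<bullet> (?N *v x) \<le> \<mu> * (x \<bullet> (mat 1 *v x))"
      by (rule weak_eigenvalue_upper_bound[OF T False transpose_gram spd_mat_1]) (rule that)
    obtain \<eta> where \<eta>: "\<eta> \<in> ?T" "\<eta> \<noteq> 0" "?N *v \<eta> = \<mu> *\<^sub>R \<eta>"
      by (rule weak_eigenvector_invariant[OF T inv \<mu>])
    have "\<mu> * (\<eta> \<bullet> \<eta>) = (R *v \<eta>) \<bullet> (R *v \<eta>)" using inner_gram[of \<eta> R \<eta>] \<eta>(3) by simp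
    then have "0 \<le> \<mu> * (\<eta> \<bullet> \<eta>)" by simp
    moreover have "0 < \<eta> \<bullet> \<eta>" using \<eta>(2) by simp
    ultimately have \<mu>0: "0 \<le> \<mu>" by (simp add: zero_le_mult_iff)
    have "min s (sqrt \<mu>) \<le> singular_value R 2"
      using \<psi> s \<eta> \<mu>0 by (intro second_singular_value_ge[of \<psi> R s \<eta>]) auto
    then have le: "sqrt \<mu> \<le> singular_value R 2" using gap by linarith
    have "(norm (R *v b))\<^sup>2 \<le> \<mu> * (norm b)\<^sup>2"
      using ub[of b] b by (simp add: inner_gram dot_square_norm)
    then have "norm (R *v b) \<le> sqrt (\<mu> * (norm b)\<^sup>2)" by (rule real_le_rsqrt)
    also have "\<dots> = sqrt \<mu> * norm b" by (simp add: real_sqrt_mult)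
    also have "\<dots> \<le> singular_value R 2 * norm b" using le by (intro mult_right_mono) auto
    finally show ?thesis .
  qed
qed

text \<open>An eigenvector of \<open>R\<^sup>T R\<close> for the second singular value is orthogonal to \<open>\<psi>\<close>, because the two
  eigenvalues differ; its partner is its image under \<open>R\<close>, rescaled.\<close>

lemma second_singular_vectors:
  fixes R :: "real^'n^'m"
  assumes uv: "unit_singular_vectors R s \<phi> \<psi>" and gap: "singular_value R 2 < s"
    and pos: "0 < singular_value R 2"
  obtains a b where "b \<noteq> 0" "R *v b = singular_value R 2 *\<^sub>R a" "transpose R *v a = singular_value R 2 *\<^sub>R b"
    "\<phi> \<bullet> a = 0" "\<psi> \<bullet> b = 0"
proof -
  let ?t = "singular_value R 2"
  obtain b where b: "b \<noteq> 0" "(transpose R ** R) *v b = ?t\<^sup>2 *\<^sub>R b"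
    by (rule singular_value_vector[OF pos])
  have \<psi>: "R *v \<psi> = s *\<^sub>R \<phi>" "transpose R *v \<phi> = s *\<^sub>R \<psi>"
    using uv by (auto simp: unit_singular_vectors_def)
  then have "(transpose R ** R) *v \<psi> = s\<^sup>2 *\<^sub>R \<psi>"
    by (simp add: matrix_vector_mul_assoc[symmetric] matrix_vector_mult_scaleR power2_eq_square
        del: transpose_matrix_vector)
  then have "s\<^sup>2 * (\<psi> \<bullet> b) = ?t\<^sup>2 * (\<psi> \<bullet> b)"
    using inner_gram[of \<psi> R b] inner_gram[of b R \<psi>] b(2) by (simp add: inner_commute)
  moreover have "s\<^sup>2 > ?t\<^sup>2" using gap pos by (intro power_strict_mono) auto
  ultimately have \<psi>b: "\<psi> \<bullet> b = 0" by auto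
  let ?a = "(1 / ?t) *\<^sub>R (R *v b)"
  show thesis
  proof (rule that[of b ?a])
    show "R *v b = ?t *\<^sub>R ?a" using pos by simp
    show "transpose R *v ?a = ?t *\<^sub>R b"
      using b(2) pos by (simp add: matrix_vector_mult_scaleR matrix_vector_mul_assoc power2_eq_square
          del: transpose_matrix_vector)
    have "\<phi> \<bullet> (R *v b) = (transpose R *v \<phi>) \<bullet> b" by (simp add: dot_lmul_matrix)
    then show "\<phi> \<bullet> ?a = 0" using \<psi>(2) \<psi>b by simp
  qed (use b \<psi>b in auto)
qed

section \<open>Block vectors\<close>

definition left_part :: "real^('m::finite + 'n::finite) \<Rightarrow> real^'m" where
  "left_part z = (\<chi> a. z $ Inl a)"

definition right_part :: "real^('m::finite + 'n::finite) \<Rightarrow> real^'n" where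
  "right_part z = (\<chi> b. z $ Inr b)"

lemma parts_vec_join [simp]: "left_part (vec_join u v) = u" "right_part (vec_join u v) = v"
  by (simp_all add: left_part_def right_part_def vec_join_def)

lemma vec_join_parts [simp]: "vec_join (left_part z) (right_part z) = z"
  by (simp add: left_part_def right_part_def vec_join_def vec_eq_iff split: sum.split)

lemma linear_left_part: "linear left_part" and linear_right_part: "linear right_part"
  by (auto simp: left_part_def right_part_def vec_eq_iff intro!: linearI)

lemma bounded_linear_parts: "bounded_linear left_part" "bounded_linear right_part"
  using linear_left_part linear_right_part linear_conv_bounded_linear by blast+

lemma parts_simps [simp]:
  "left_part (x + y) = left_part x + left_part y" "right_part (x + y) = right_part x + right_part y"
  "left_part (r *\<^sub>R x) = r *\<^sub>R left_part x" "right_part (r *\<^sub>R x) = r *\<^sub>R right_part x"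
  "left_part 0 = 0" "right_part 0 = 0"
  by (simp_all add: left_part_def right_part_def vec_eq_iff)

lemma inner_parts: "x \<bullet> y = left_part x \<bullet> left_part y + right_part x \<bullet> right_part y"
  for x y :: "real^('m::finite + 'n::finite)"
proof -
  have "x \<bullet> y = (\<Sum>i\<in>UNIV <+> UNIV. x $ i \<bullet> y $ i)"
    by (simp add: inner_vec_def UNIV_Plus_UNIV)
  also have "\<dots> = left_part x \<bullet> left_part y + right_part x \<bullet> right_part y"
    by (subst sum.Plus) (simp_all add: inner_vec_def left_part_def right_part_def)
  finally show ?thesis .
qed

lemma inner_vec_join: "vec_join u v \<bullet> vec_join a b = u \<bullet> a + v \<bullet> b"
  by (simp add: inner_parts)

lemma block_matrix_mult:
  "block_matrix A B C D *v z =
    vec_join (A *v left_part z + B *v right_part z) (C *v left_part z + D *v right_part z)"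
proof -
  have s: "(\<Sum>j\<in>UNIV. h j) = (\<Sum>a\<in>UNIV. h (Inl a)) + (\<Sum>b\<in>UNIV. h (Inr b))"
    for h :: "'c::finite + 'd::finite \<Rightarrow> real"
    using sum.Plus[of "UNIV :: 'c set" "UNIV :: 'd set" h] by (simp add: UNIV_Plus_UNIV)
  show ?thesis
    by (simp add: vec_eq_iff matrix_vector_mult_def block_matrix_def vec_join_def s
        left_part_def right_part_def split: sum.split)
qed

lemma vec_join_linear:
  "vec_join u v = vec_join u 0 + vec_join 0 v"
  "linear (\<lambda>u. vec_join u 0)" "linear (\<lambda>v. vec_join 0 v)"
  by (auto simp: vec_join_def vec_eq_iff intro!: linearI split: sum.split)

lemma vec_join_eq_0_iff: "vec_join u v = 0 \<longleftrightarrow> u = 0 \<and> v = 0"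
  by (auto simp: vec_join_def vec_eq_iff split: sum.split)

lemma smooth_map_vec_join:
  assumes "smooth_map S h" "smooth_map S k" shows "smooth_map S (\<lambda>x. vec_join (h x) (k x))"
proof -
  have "smooth_map S (\<lambda>x. vec_join (h x) 0 + vec_join 0 (k x))"
    using vec_join_linear(2,3)
    by (intro smooth_map_add smooth_map_linear[OF _ assms(1)] smooth_map_linear[OF _ assms(2)])
       (simp_all add: linear_conv_bounded_linear)
  then show ?thesis by (simp add: vec_join_linear(1)[symmetric])
qed

lemma blkdiag_mult: "blkdiag A D *v z = vec_join (A *v left_part z) (D *v right_part z)"
  by (simp add: blkdiag_def block_matrix_mult)

lemma spd_blkdiag_iff: "spd (blkdiag A D) \<longleftrightarrow> spd A \<and> spd D"
proof
  assume s: "spd (blkdiag A D)"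
  have "transpose A = A"
    using spd_symD[OF s, of "vec_join _ 0" "vec_join _ 0"]
    by (simp add: symmetric_matrix_iff blkdiag_mult inner_vec_join)
  moreover have "transpose D = D"
    using spd_symD[OF s, of "vec_join 0 _" "vec_join 0 _"]
    by (simp add: symmetric_matrix_iff blkdiag_mult inner_vec_join)
  moreover have "x \<bullet> (A *v x) > 0" if "x \<noteq> 0" for x
    using spd_posD[OF s, of "vec_join x 0"] that
    by (simp add: blkdiag_mult inner_vec_join vec_join_eq_0_iff)
  moreover have "x \<bullet> (D *v x) > 0" if "x \<noteq> 0" for x
    using spd_posD[OF s, of "vec_join 0 x"] that
    by (simp add: blkdiag_mult inner_vec_join vec_join_eq_0_iff)
  ultimately show "spd A \<and> spd D" by (simp add: spd_def)
next
  assume s: "spd A \<and> spd D"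
  then have A: "spd A" and D: "spd D" by auto
  have nn: "x \<bullet> (A *v x) \<ge> 0" "y \<bullet> (D *v y) \<ge> 0" for x y
    using spd_posD[OF A, of x] spd_posD[OF D, of y] by (cases "x = 0"; cases "y = 0"; simp)+
  show "spd (blkdiag A D)"
    unfolding spd_def symmetric_matrix_iff
  proof (intro conjI allI impI)
    fix x y
    show "x \<bullet> (blkdiag A D *v y) = y \<bullet> (blkdiag A D *v x)"
      using spd_symD[OF A, of "left_part x" "left_part y"] spd_symD[OF D, of "right_part x" "right_part y"]
      by (simp add: blkdiag_mult inner_parts)
  next
    fix x :: "real^('a+'b)" assume "x \<noteq> 0"
    then have "left_part x \<noteq> 0 \<or> right_part x \<noteq> 0"
      using vec_join_eq_0_iff[of "left_part x" "right_part x"] by simp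
    then show "x \<bullet> (blkdiag A D *v x) > 0"
      using nn(1)[of "left_part x"] nn(2)[of "right_part x"] spd_posD[OF A, of "left_part x"] spd_posD[OF D, of "right_part x"]
      by (auto simp: blkdiag_mult inner_parts)
  qed
qed

section \<open>Curves and tangent spaces\<close>

lemma curve_throughD:
  assumes \<gamma>: "curve_through S z \<xi> \<gamma>"
    and F: "(F has_derivative F') (at z)" "open U" "z \<in> U" "\<And>x. x \<in> U \<Longrightarrow> x \<in> S \<Longrightarrow> F x = h x"
  shows "((\<lambda>t. h (\<gamma> t)) has_vector_derivative F' \<xi>) (at 0)"
proof -
  obtain e where e: "e > 0" "smooth_open {-e<..<e} \<gamma>" "\<gamma> ` {-e<..<e} \<subseteq> S" and \<gamma>0: "\<gamma> 0 = z"
    and d: "(\<gamma> has_vector_derivative \<xi>) (at 0)"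
    using \<gamma> by (auto simp: curve_through_def)
  define I where "I = {-e<..<e} \<inter> \<gamma> -` U"
  have "open I"
    unfolding I_def
    by (rule continuous_open_preimage[OF smooth_open_imp_continuous_on[OF e(2)] _ F(2)]) simp
  have "0 \<in> I" using e(1) \<gamma>0 F(3) by (simp add: I_def)
  have "((\<lambda>t. F (\<gamma> t)) has_derivative (\<lambda>t. F' (t *\<^sub>R \<xi>))) (at 0)"
    using d F(1) \<gamma>0 has_derivative_compose[of \<gamma> _ 0 UNIV F F'] by (simp add: has_vector_derivative_def)
  then have "((\<lambda>t. F (\<gamma> t)) has_derivative (\<lambda>t. t *\<^sub>R F' \<xi>)) (at 0)"
    using linear_scale[OF has_derivative_linear[OF F(1)]] by simp
  moreover have "F (\<gamma> t) = h (\<gamma> t)" if "t \<in> I" for t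
  proof (rule F(4))
    show "\<gamma> t \<in> U" "\<gamma> t \<in> S" using that e(3) by (auto simp: I_def)
  qed
  ultimately have "((\<lambda>t. h (\<gamma> t)) has_derivative (\<lambda>t. t *\<^sub>R F' \<xi>)) (at 0)"
    by (rule has_derivative_transform_within_open[OF _ \<open>open I\<close> \<open>0 \<in> I\<close>])
  then show ?thesis by (simp add: has_vector_derivative_def)
qed

text \<open>The chain rule computes the derivative along every curve through the tangent vector; that such a
  curve exists makes the value unique.\<close>

lemma dir_deriv_eq:
  assumes "\<xi> \<in> tangent_space S z"
    and F: "(F has_derivative F') (at z)" "open U" "z \<in> U" "\<And>x. x \<in> U \<Longrightarrow> x \<in> S \<Longrightarrow> F x = h x"
  shows "dir_deriv S h z \<xi> = F' \<xi>"
  unfolding dir_deriv_def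
proof (rule the_equality)
  show "\<forall>\<gamma>. curve_through S z \<xi> \<gamma> \<longrightarrow> ((\<lambda>t. h (\<gamma> t)) has_vector_derivative F' \<xi>) (at 0)"
    using curve_throughD[OF _ F] by simp
  obtain \<gamma> where \<gamma>: "curve_through S z \<xi> \<gamma>" using assms(1) by (auto simp: tangent_space_def)
  show "d = F' \<xi>"
    if "\<forall>\<gamma>. curve_through S z \<xi> \<gamma> \<longrightarrow> ((\<lambda>t. h (\<gamma> t)) has_vector_derivative d) (at 0)" for d
    using vector_derivative_unique_at[OF that[rule_format, OF \<gamma>] curve_throughD[OF \<gamma> F]] .
qed

text \<open>The stereographic parametrisation of the ellipse spanned by \<open>u\<close> and \<open>a\<close>. Being rational in the
  parameter, it is smooth by the closure rules, and it covers \<open>a = 0\<close> as well.\<close>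

lemma ellipsoid_curve:
  fixes u a :: "real^'n" and A :: "real^'n^'n"
  assumes A: "spd A" and u: "u \<in> ellipsoid A" and a: "u \<bullet> (A *v a) = 0"
  obtains \<gamma> :: "real \<Rightarrow> real^'n" where "smooth_open UNIV \<gamma>" "\<And>t. \<gamma> t \<in> ellipsoid A" "\<gamma> 0 = u"
    "(\<gamma> has_vector_derivative a) (at 0)"
proof -
  \<comment> \<open>With the factor \<open>1/4\<close> the initial velocity is \<open>a\<close> itself and not \<open>2 a\<close>.\<close>
  define c where "c = (a \<bullet> (A *v a)) / 4"
  have c: "c \<ge> 0" using spd_posD[OF A, of a] by (cases "a = 0") (simp_all add: c_def)
  have pos: "1 + c * (t * t) > 0" for t using c by (simp add: add_pos_nonneg)
  define \<gamma> where "\<gamma> t = inverse (1 + c * (t * t)) *\<^sub>R ((1 + (- c) * (t * t)) *\<^sub>R u + t *\<^sub>R a)" for t :: real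
  note bil = smooth_open_bilinear[OF open_UNIV bounded_bilinear_scaleR]
    smooth_open_bilinear[OF open_UNIV bounded_bilinear_mult]
  have sq: "smooth_open UNIV (\<lambda>t. 1 + r * (t * t))" for r :: real
    by (rule smooth_open_add[OF open_UNIV smooth_open_const
        bil(2)[OF smooth_open_const bil(2)[OF smooth_open_ident[OF open_UNIV] smooth_open_ident[OF open_UNIV]]]])
  have "smooth_open UNIV \<gamma>"
    unfolding \<gamma>_def
  proof (rule bil(1)[OF smooth_open_inverse[OF open_UNIV sq] smooth_open_add[OF open_UNIV
          bil(1)[OF sq smooth_open_const] bil(1)[OF smooth_open_ident[OF open_UNIV] smooth_open_const]]])
    show "1 + c * (t * t) \<noteq> 0" for t using pos[of t] by simp
  qed
  moreover have "\<gamma> t \<in> ellipsoid A" for t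
  proof -
    let ?w = "(1 + (- c) * (t * t)) *\<^sub>R u + t *\<^sub>R a"
    have "?w \<bullet> (A *v ?w) = (1 + (- c) * (t * t))\<^sup>2 * (u \<bullet> (A *v u)) + 2 * t * (1 + (- c) * (t * t)) * (u \<bullet> (A *v a))
        + t\<^sup>2 * (a \<bullet> (A *v a))"
      using spd_symD[OF A, of a u]
      by (simp add: matrix_vector_right_distrib matrix_vector_mult_scaleR inner_add_left inner_add_right
          power2_eq_square algebra_simps)
    also have "\<dots> = (1 + (- c) * (t * t))\<^sup>2 + t\<^sup>2 * (4 * c)"
      using u a by (simp add: ellipsoid_def c_def)
    also have "\<dots> = (1 + c * (t * t))\<^sup>2" by (simp add: power2_eq_square algebra_simps)
    finally have w: "?w \<bullet> (A *v ?w) = (1 + c * (t * t))\<^sup>2" .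
    have "\<gamma> t \<bullet> (A *v \<gamma> t) = (inverse (1 + c * (t * t)))\<^sup>2 * (?w \<bullet> (A *v ?w))"
      unfolding \<gamma>_def matrix_vector_mult_scaleR inner_scaleR_left inner_scaleR_right
      by (simp only: power2_eq_square mult.assoc)
    also have "\<dots> = (inverse (1 + c * (t * t)) * (1 + c * (t * t)))\<^sup>2"
      unfolding w by (simp only: power_mult_distrib)
    also have "\<dots> = 1" using pos[of t] by simp
    finally show ?thesis by (simp add: ellipsoid_def)
  qed
  moreover have "\<gamma> 0 = u" by (simp add: \<gamma>_def)
  moreover have "(\<gamma> has_vector_derivative a) (at 0)"
  proof -
    have 1: "((\<lambda>t. inverse (1 + c * (t * t))) has_field_derivative 0) (at 0)"
      by (rule derivative_eq_intros refl | simp)+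
    have "((\<lambda>t. 1 + (- c) * (t * t)) has_field_derivative 0) (at 0)"
      by (rule derivative_eq_intros refl | simp)+
    from has_vector_derivative_scaleR[OF this has_vector_derivative_const[of u]]
    have 2: "((\<lambda>t. (1 + (- c) * (t * t)) *\<^sub>R u) has_vector_derivative 0) (at 0)" by simp
    from has_vector_derivative_scaleR[OF DERIV_ident has_vector_derivative_const[of a]]
    have 3: "((\<lambda>t. t *\<^sub>R a) has_vector_derivative a) (at 0)" by simp
    from has_vector_derivative_scaleR[OF 1 has_vector_derivative_add[OF 2 3]]
    show ?thesis unfolding \<gamma>_def by simp
  qed
  ultimately show thesis by (rule that)
qed

definition product_tangent ::
  "real^'m^'m \<Rightarrow> real^'n^'n \<Rightarrow> real^('m + 'n) \<Rightarrow> (real^('m + 'n)) set" where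
  "product_tangent A C z =
    {\<xi>. left_part z \<bullet> (A *v left_part \<xi>) = 0 \<and> right_part z \<bullet> (C *v right_part \<xi>) = 0}"

lemma subspace_product_tangent: "subspace (product_tangent A C z)"
  by (auto simp: subspace_def product_tangent_def matrix_vector_right_distrib matrix_vector_mult_scaleR
      inner_add_right)

lemma mem_ellipsoid_product:
  "z \<in> join_set P Q \<longleftrightarrow> left_part z \<in> P \<and> right_part z \<in> Q"
proof
  assume "left_part z \<in> P \<and> right_part z \<in> Q"
  then have "\<exists>u v. z = vec_join u v \<and> u \<in> P \<and> v \<in> Q"
    by (intro exI[of _ "left_part z"] exI[of _ "right_part z"]) simp
  then show "z \<in> join_set P Q" by (simp add: join_set_def)
qed (auto simp: join_set_def)

lemma quadratic_form_derivative:
  fixes A :: "real^'n^'n"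
  assumes A: "transpose A = A" and L: "bounded_linear L"
  shows "((\<lambda>x. L x \<bullet> (A *v L x)) has_derivative (\<lambda>\<xi>. 2 * (L x \<bullet> (A *v L \<xi>)))) (at x)"
proof -
  have L': "(L has_derivative L) (at x)" by (rule bounded_linear_imp_has_derivative[OF L])
  have AL: "((\<lambda>x. A *v L x) has_derivative (\<lambda>\<xi>. A *v L \<xi>)) (at x)"
    by (rule bounded_linear.has_derivative[OF matrix_vector_mul_bounded_linear L'])
  have "L \<xi> \<bullet> (A *v L x) = L x \<bullet> (A *v L \<xi>)" for \<xi> using A symmetric_matrix_iff by blast
  with has_derivative_inner[OF L' AL] show ?thesis by simp
qed

text \<open>Curves on the product keep both quadratic forms equal to \<open>1\<close>, which gives one inclusion by
  differentiation; the curves of \<open>ellipsoid_curve\<close> in the two factors give the other.\<close>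

lemma tangent_space_ellipsoid_product:
  fixes A :: "real^'m^'m" and C :: "real^'n^'n"
  assumes A: "spd A" and C: "spd C" and z: "z \<in> join_set (ellipsoid A) (ellipsoid C)"
  shows "tangent_space (join_set (ellipsoid A) (ellipsoid C)) z = product_tangent A C z"
proof
  let ?S = "join_set (ellipsoid A) (ellipsoid C)"
  have zp: "left_part z \<in> ellipsoid A" "right_part z \<in> ellipsoid C"
    using z by (auto simp: mem_ellipsoid_product)
  show "tangent_space ?S z \<subseteq> product_tangent A C z"
  proof
    fix \<xi> assume "\<xi> \<in> tangent_space ?S z"
    then obtain \<gamma> where \<gamma>: "curve_through ?S z \<xi> \<gamma>" by (auto simp: tangent_space_def)
    have const: "((\<lambda>t. 1 :: real) has_vector_derivative 0) (at 0)" by (rule has_vector_derivative_const)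
    have "((\<lambda>t. 1) has_vector_derivative 2 * (left_part z \<bullet> (A *v left_part \<xi>))) (at 0)"
      by (rule curve_throughD[OF \<gamma> quadratic_form_derivative[OF _ bounded_linear_parts(1)] open_UNIV])
         (use A in \<open>auto simp: spd_def mem_ellipsoid_product ellipsoid_def\<close>)
    moreover have "((\<lambda>t. 1) has_vector_derivative 2 * (right_part z \<bullet> (C *v right_part \<xi>))) (at 0)"
      by (rule curve_throughD[OF \<gamma> quadratic_form_derivative[OF _ bounded_linear_parts(2)] open_UNIV])
         (use C in \<open>auto simp: spd_def mem_ellipsoid_product ellipsoid_def\<close>)
    ultimately have "2 * (left_part z \<bullet> (A *v left_part \<xi>)) = 0" "2 * (right_part z \<bullet> (C *v right_part \<xi>)) = 0"
      using vector_derivative_unique_at[OF _ const] by blast+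
    then show "\<xi> \<in> product_tangent A C z"
      by (simp add: product_tangent_def)
  qed
  show "product_tangent A C z \<subseteq> tangent_space ?S z"
  proof
    fix \<xi> assume "\<xi> \<in> product_tangent A C z"
    then have \<xi>: "left_part z \<bullet> (A *v left_part \<xi>) = 0" "right_part z \<bullet> (C *v right_part \<xi>) = 0"
      by (auto simp: product_tangent_def)
    obtain \<alpha> :: "real \<Rightarrow> real^'m" where \<alpha>: "smooth_open UNIV \<alpha>" "\<And>t. \<alpha> t \<in> ellipsoid A" "\<alpha> 0 = left_part z"
      "(\<alpha> has_vector_derivative left_part \<xi>) (at 0)"
      by (rule ellipsoid_curve[OF A zp(1) \<xi>(1)]) (rule that)
    obtain \<beta> :: "real \<Rightarrow> real^'n" where \<beta>: "smooth_open UNIV \<beta>" "\<And>t. \<beta> t \<in> ellipsoid C" "\<beta> 0 = right_part z"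
      "(\<beta> has_vector_derivative right_part \<xi>) (at 0)"
      by (rule ellipsoid_curve[OF C zp(2) \<xi>(2)]) (rule that)
    note bl = vec_join_linear(2,3)[unfolded linear_conv_bounded_linear]
    let ?\<gamma> = "\<lambda>t. vec_join (\<alpha> t) 0 + vec_join 0 (\<beta> t)"
    have "smooth_open UNIV ?\<gamma>"
      by (rule smooth_open_add[OF open_UNIV smooth_open_linear[OF open_UNIV bl(1) \<alpha>(1)]
            smooth_open_linear[OF open_UNIV bl(2) \<beta>(1)]])
    then have "smooth_open {-1<..<1} ?\<gamma>" by (rule smooth_open_subset[rotated 3]) auto
    moreover have "(?\<gamma> has_vector_derivative (vec_join (left_part \<xi>) 0 + vec_join 0 (right_part \<xi>))) (at 0)"
      by (rule has_vector_derivative_add[OF bounded_linear.has_vector_derivative[OF bl(1) \<alpha>(4)]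
            bounded_linear.has_vector_derivative[OF bl(2) \<beta>(4)]])
    moreover have "?\<gamma> t = vec_join (\<alpha> t) (\<beta> t)" for t
      by (rule vec_join_linear(1)[symmetric])
    moreover have "vec_join (left_part \<xi>) 0 + vec_join 0 (right_part \<xi>) = \<xi>"
      by (simp add: vec_join_linear(1)[symmetric])
    ultimately have "curve_through ?S z \<xi> (\<lambda>t. vec_join (\<alpha> t) (\<beta> t))"
      using \<alpha>(2,3) \<beta>(2,3)
      unfolding curve_through_def by (auto simp: mem_ellipsoid_product intro!: exI[of _ 1])
    then show "\<xi> \<in> tangent_space ?S z" by (auto simp: tangent_space_def)
  qed
qed

section \<open>The Riemannian gradient and Hessian\<close>

text \<open>The Riesz representative, with respect to \<open>M\<close>, of the functional \<open>c\<close> on the hyperplane orthogonal to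
  \<open>n\<close>: the solution \<open>\<zeta>\<close> of \<open>M \<zeta> = c - \<alpha> n\<close> with the multiplier \<open>\<alpha>\<close> chosen such that \<open>n \<bullet> \<zeta> = 0\<close>.
  The formula is rational in \<open>M\<close>, \<open>n\<close> and \<open>c\<close>.\<close>

definition constrained_solve :: "real^'n^'n \<Rightarrow> real^'n \<Rightarrow> real^'n \<Rightarrow> real^'n" where
  "constrained_solve M n c = matrix_inv M *v c -
    ((n \<bullet> (matrix_inv M *v c)) * inverse (n \<bullet> (matrix_inv M *v n))) *\<^sub>R (matrix_inv M *v n)"

lemma matrix_inv_mult:
  fixes M :: "real^'n^'n"
  assumes "spd M" shows "M *v (matrix_inv M *v x) = x"
  using matrix_inv_inverse(1)[OF spd_invertible[OF assms]] by (simp add: matrix_vector_mul_assoc)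

lemma matrix_inv_pos:
  fixes n :: "real^'n"
  assumes M: "spd M" and n: "n \<noteq> 0" shows "n \<bullet> (matrix_inv M *v n) > 0"
proof -
  have "matrix_inv M *v n \<noteq> 0" using matrix_inv_mult[OF M, of n] n by auto
  from spd_posD[OF M this] show ?thesis by (simp add: matrix_inv_mult[OF M] inner_commute)
qed

lemma constrained_solve:
  fixes n :: "real^'n"
  assumes M: "spd M" and n: "n \<noteq> 0"
  shows "n \<bullet> constrained_solve M n c = 0"
    "n \<bullet> a = 0 \<Longrightarrow> constrained_solve M n c \<bullet> (M *v a) = c \<bullet> a"
proof -
  show "n \<bullet> constrained_solve M n c = 0"
    using matrix_inv_pos[OF M n] by (simp add: constrained_solve_def inner_diff_right)
  assume a: "n \<bullet> a = 0"
  have "constrained_solve M n c \<bullet> (M *v a) = a \<bullet> (M *v constrained_solve M n c)"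
    by (rule spd_symD[OF M])
  also have "\<dots> = c \<bullet> a"
    using a by (simp add: constrained_solve_def matrix_vector_mult_diff_distrib matrix_vector_mult_scaleR
        matrix_inv_mult[OF M] inner_diff_right inner_commute)
  finally show "constrained_solve M n c \<bullet> (M *v a) = c \<bullet> a" .
qed

lemma smooth_map_inner:
  "smooth_map S h \<Longrightarrow> smooth_map S k \<Longrightarrow> smooth_map S (\<lambda>x. h x \<bullet> k x)"
  by (rule smooth_map_bilinear[OF bounded_bilinear_inner])

lemma smooth_map_constrained_solve:
  fixes n c :: "'a::euclidean_space \<Rightarrow> real^'n"
  assumes M: "smooth_map S M" "\<And>x. x \<in> S \<Longrightarrow> spd (M x)"
    and n: "smooth_map S n" "\<And>x. x \<in> S \<Longrightarrow> n x \<noteq> 0" and c: "smooth_map S c"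
  shows "smooth_map S (\<lambda>x. constrained_solve (M x) (n x) (c x))"
  unfolding constrained_solve_def
proof -
  note p = smooth_map_solve[OF M(1) c M(2)] and r = smooth_map_solve[OF M(1) n(1) M(2)]
  have "smooth_map S (\<lambda>x. inverse (n x \<bullet> (matrix_inv (M x) *v n x)))"
  proof (rule smooth_map_inverse[OF smooth_map_inner[OF n(1) r]])
    show "n x \<bullet> (matrix_inv (M x) *v n x) \<noteq> 0" if "x \<in> S" for x
      using matrix_inv_pos[OF M(2) n(2), OF that that] by simp
  qed
  then show "smooth_map S (\<lambda>x. matrix_inv (M x) *v c x -
     ((n x \<bullet> (matrix_inv (M x) *v c x)) * inverse (n x \<bullet> (matrix_inv (M x) *v n x))) *\<^sub>R
       (matrix_inv (M x) *v n x))"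
    by (intro smooth_map_diff p smooth_map_bilinear[OF bounded_bilinear_scaleR]
        smooth_map_bilinear[OF bounded_bilinear_mult] r smooth_map_inner n(1))
qed

locale preconditioned_ellipsoids =
  fixes A :: "real^'m^'m" and C :: "real^'n^'n" and G :: "real^'n^'m"
    and M :: "real^('m + 'n) \<Rightarrow> real^('m + 'n)^('m + 'n)"
  assumes A: "spd A" and C: "spd C"
    and precond: "smooth_preconditioning (ellipsoid A) (ellipsoid C) M"
begin

abbreviation "S \<equiv> join_set (ellipsoid A) (ellipsoid C)"
abbreviation "B \<equiv> block_matrix 0 G (transpose G) 0"
abbreviation "g \<equiv> precond_metric M"

definition objective :: "real^('m + 'n) \<Rightarrow> real" where
  "objective z = - (1/2) * (z \<bullet> (B *v z))"

lemma inner_B: "x \<bullet> (B *v y) = left_part x \<bullet> (G *v right_part y) + right_part x \<bullet> (transpose G *v left_part y)"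
  by (simp add: inner_parts block_matrix_mult del: transpose_matrix_vector)

lemma B_sym: "x \<bullet> (B *v y) = y \<bullet> (B *v x)"
  unfolding inner_B inner_transpose_mult by simp

lemma tangent: "z \<in> S \<Longrightarrow> tangent_space S z = product_tangent A C z"
  by (rule tangent_space_ellipsoid_product[OF A C])

lemma obtain_blocks:
  obtains Mxx Myy where
    "smooth_map S (\<lambda>z. Mxx (left_part z))" "smooth_map S (\<lambda>z. Myy (right_part z))"
    "\<And>z. z \<in> S \<Longrightarrow> spd (Mxx (left_part z))" "\<And>z. z \<in> S \<Longrightarrow> spd (Myy (right_part z))"
    "\<And>z. z \<in> S \<Longrightarrow> M z = blkdiag (Mxx (left_part z)) (Myy (right_part z))"
proof -
  obtain Mxx Myy where M: "smooth_map (ellipsoid A) Mxx" "\<forall>u\<in>ellipsoid A. spd (Mxx u)"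
      "smooth_map (ellipsoid C) Myy" "\<forall>v\<in>ellipsoid C. spd (Myy v)"
      "\<forall>u\<in>ellipsoid A. \<forall>v\<in>ellipsoid C. M (vec_join u v) = blkdiag (Mxx u) (Myy v)"
    using precond unfolding smooth_preconditioning_def by blast
  have parts: "left_part z \<in> ellipsoid A" "right_part z \<in> ellipsoid C" if "z \<in> S" for z
    using that by (auto simp: mem_ellipsoid_product)
  show thesis
  proof (rule that)
    show "smooth_map S (\<lambda>z. Mxx (left_part z))"
      by (rule smooth_map_compose_linear[OF bounded_linear_parts(1) M(1)]) (use parts in auto)
    show "smooth_map S (\<lambda>z. Myy (right_part z))"
      by (rule smooth_map_compose_linear[OF bounded_linear_parts(2) M(3)]) (use parts in auto)
    fix z assume z: "z \<in> S"
    show "spd (Mxx (left_part z))" "spd (Myy (right_part z))" using M(2,4) parts[OF z] by auto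
    show "M z = blkdiag (Mxx (left_part z)) (Myy (right_part z))"
      using M(5)[rule_format, OF parts[OF z]] by simp
  qed
qed

lemma spd_M: "z \<in> S \<Longrightarrow> spd (M z)"
  by (rule obtain_blocks) (simp add: spd_blkdiag_iff)

lemma objective_derivative: "(objective has_derivative (\<lambda>\<xi>. - (z \<bullet> (B *v \<xi>)))) (at z)"
proof -
  have "transpose B = B" unfolding symmetric_matrix_iff using B_sym by blast
  from quadratic_form_derivative[OF this bounded_linear_ident, of z]
  have "((\<lambda>x. - (1/2) * (x \<bullet> (B *v x))) has_derivative (\<lambda>\<xi>. - (1/2) * (2 * (z \<bullet> (B *v \<xi>))))) (at z)"
    by (rule has_derivative_mult_right)
  then show ?thesis by (simp add: objective_def[abs_def])
qed

lemma dir_deriv_objective: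
  assumes "z \<in> S" "\<xi> \<in> tangent_space S z"
  shows "dir_deriv S objective z \<xi> = - (z \<bullet> (B *v \<xi>))"
  by (rule dir_deriv_eq[OF assms(2) objective_derivative open_UNIV]) auto

lemma riesz_unique:
  assumes z: "z \<in> S" and T: "\<zeta> \<in> tangent_space S z" "\<zeta>' \<in> tangent_space S z"
    and eq: "\<And>\<xi>. \<xi> \<in> tangent_space S z \<Longrightarrow> g z \<zeta> \<xi> = g z \<zeta>' \<xi>"
  shows "\<zeta> = \<zeta>'"
proof (rule ccontr)
  assume "\<zeta> \<noteq> \<zeta>'"
  have "\<zeta> - \<zeta>' \<in> tangent_space S z"
    using T subspace_diff[OF subspace_product_tangent] by (auto simp: tangent[OF z])
  from eq[OF this] have "(\<zeta> - \<zeta>') \<bullet> (M z *v (\<zeta> - \<zeta>')) = 0"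
    by (simp add: precond_metric_def inner_diff_left)
  with spd_posD[OF spd_M[OF z], of "\<zeta> - \<zeta>'"] \<open>\<zeta> \<noteq> \<zeta>'\<close> show False by simp
qed

lemma normal_nz: 
  assumes "z \<in> S" shows "A *v left_part z \<noteq> 0" "C *v right_part z \<noteq> 0"
  using assms by (auto simp: mem_ellipsoid_product ellipsoid_def)

text \<open>The preconditioner is block diagonal, so the gradient solves one problem of the form
  \<open>constrained_solve\<close> in each factor, with normals \<open>A u\<close> and \<open>C v\<close>; this shows its smoothness.\<close>

lemma gradient:
  shows gradient_vector_field: "vector_field S (riemannian_grad S g objective)"
    and gradient_tangent: "z \<in> S \<Longrightarrow> riemannian_grad S g objective z \<in> tangent_space S z"
    and gradient_riesz: "z \<in> S \<Longrightarrow> \<xi> \<in> tangent_space S z \<Longrightarrow>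
      g z (riemannian_grad S g objective z) \<xi> = - (z \<bullet> (B *v \<xi>))"
proof -
  obtain Mxx Myy where sm: "smooth_map S (\<lambda>z. Mxx (left_part z))" "smooth_map S (\<lambda>z. Myy (right_part z))"
    and pd: "\<And>z. z \<in> S \<Longrightarrow> spd (Mxx (left_part z))" "\<And>z. z \<in> S \<Longrightarrow> spd (Myy (right_part z))"
    and M: "\<And>z. z \<in> S \<Longrightarrow> M z = blkdiag (Mxx (left_part z)) (Myy (right_part z))"
    by (rule obtain_blocks) (rule that)
  define \<zeta> where "\<zeta> z = vec_join
      (constrained_solve (Mxx (left_part z)) (A *v left_part z) (- (G *v right_part z)))
      (constrained_solve (Myy (right_part z)) (C *v right_part z) (- (transpose G *v left_part z)))" for z
  have \<zeta>T: "\<zeta> z \<in> tangent_space S z" if z: "z \<in> S" for z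
    using constrained_solve(1)[OF pd(1)[OF z] normal_nz(1)[OF z]]
      constrained_solve(1)[OF pd(2)[OF z] normal_nz(2)[OF z]]
      spd_symD[OF A] spd_symD[OF C]
    by (simp add: tangent[OF z] \<zeta>_def product_tangent_def inner_commute del: transpose_matrix_vector)
  have \<zeta>r: "g z (\<zeta> z) \<xi> = - (z \<bullet> (B *v \<xi>))" if z: "z \<in> S" and \<xi>: "\<xi> \<in> tangent_space S z" for z \<xi>
  proof -
    have "(A *v left_part z) \<bullet> left_part \<xi> = 0" "(C *v right_part z) \<bullet> right_part \<xi> = 0"
      using \<xi> spd_symD[OF A, of "left_part \<xi>" "left_part z"] spd_symD[OF C, of "right_part \<xi>" "right_part z"]
      by (simp_all add: tangent[OF z] product_tangent_def inner_commute)
    note cs = constrained_solve(2)[OF pd(1)[OF z] normal_nz(1)[OF z] this(1)]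
      constrained_solve(2)[OF pd(2)[OF z] normal_nz(2)[OF z] this(2)]
    have "g z (\<zeta> z) \<xi> = - (G *v right_part z) \<bullet> left_part \<xi> + - (transpose G *v left_part z) \<bullet> right_part \<xi>"
      by (simp add: precond_metric_def M[OF z] blkdiag_mult inner_parts \<zeta>_def cs del: transpose_matrix_vector)
    also have "\<dots> = - (\<xi> \<bullet> (B *v z))"
      by (simp add: inner_B inner_commute del: transpose_matrix_vector)
    finally show ?thesis using B_sym by simp
  qed
  have eq: "riemannian_grad S g objective z = \<zeta> z" if z: "z \<in> S" for z
    unfolding riemannian_grad_def
  proof (rule the_equality)
    show "\<zeta> z \<in> tangent_space S z \<and> (\<forall>\<xi>\<in>tangent_space S z. g z (\<zeta> z) \<xi> = dir_deriv S objective z \<xi>)"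
      using \<zeta>T[OF z] \<zeta>r[OF z] dir_deriv_objective[OF z] by simp
    show "w = \<zeta> z"
      if "w \<in> tangent_space S z \<and> (\<forall>\<xi>\<in>tangent_space S z. g z w \<xi> = dir_deriv S objective z \<xi>)" for w
      using that \<zeta>T[OF z] \<zeta>r[OF z] dir_deriv_objective[OF z] by (intro riesz_unique[OF z]) auto
  qed
  note L = smooth_map_linear[OF bounded_linear_parts(1) smooth_map_ident]
    smooth_map_linear[OF bounded_linear_parts(2) smooth_map_ident]
  note mv = smooth_map_linear[OF matrix_vector_mul_bounded_linear]
  have "smooth_map S \<zeta>"
    unfolding \<zeta>_def
    by (intro smooth_map_vec_join smooth_map_constrained_solve sm mv L pd normal_nz
        smooth_map_linear[OF bounded_linear_minus[OF bounded_linear_ident]])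
  then have "smooth_map S (riemannian_grad S g objective)"
    by (rule smooth_map_cong) (simp add: eq)
  then show "vector_field S (riemannian_grad S g objective)"
    unfolding vector_field_def using eq \<zeta>T by simp
  show "z \<in> S \<Longrightarrow> riemannian_grad S g objective z \<in> tangent_space S z"
    using eq \<zeta>T by simp
  show "z \<in> S \<Longrightarrow> \<xi> \<in> tangent_space S z \<Longrightarrow>
      g z (riemannian_grad S g objective z) \<xi> = - (z \<bullet> (B *v \<xi>))"
    using eq \<zeta>r by simp
qed

text \<open>The field \<open>x \<mapsto> \<langle>z, x\<rangle> \<xi> - \<langle>\<xi>, x\<rangle> z\<close>, with the inner product of \<open>A\<close> and of \<open>C\<close> respectively, generates
  the rotations in the plane of \<open>z\<close> and \<open>\<xi>\<close>. It is tangent everywhere by antisymmetry, and linearity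
  makes its smoothness and its derivative immediate.\<close>

lemma linear_tangent_field:
  assumes z: "z \<in> S" and \<xi>: "\<xi> \<in> tangent_space S z"
  obtains W where "linear W" "vector_field S W" "W z = \<xi>"
proof -
  define W where "W x = vec_join
      ((left_part z \<bullet> (A *v left_part x)) *\<^sub>R left_part \<xi> - (left_part \<xi> \<bullet> (A *v left_part x)) *\<^sub>R left_part z)
      ((right_part z \<bullet> (C *v right_part x)) *\<^sub>R right_part \<xi> - (right_part \<xi> \<bullet> (C *v right_part x)) *\<^sub>R right_part z)"
    for x
  have lin: "linear W"
    unfolding W_def
    by (rule linearI)
       (simp_all add: vec_eq_iff vec_join_def matrix_vector_right_distrib matrix_vector_mult_scaleR
          inner_add_right algebra_simps split: sum.split)
  have "smooth_map S W"
    using lin by (intro smooth_map_linear[OF _ smooth_map_ident]) (simp add: linear_conv_bounded_linear)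
  moreover have "W x \<in> tangent_space S x" if x: "x \<in> S" for x
    using spd_symD[OF A, of "left_part x"] spd_symD[OF C, of "right_part x"]
    by (simp add: tangent[OF x] product_tangent_def W_def matrix_vector_mult_diff_distrib
        matrix_vector_mult_scaleR inner_diff_right inner_diff_left)
  ultimately have "vector_field S W" by (simp add: vector_field_def)
  moreover have "W z = \<xi>"
  proof -
    have "left_part z \<bullet> (A *v left_part z) = 1" "right_part z \<bullet> (C *v right_part z) = 1"
      using z by (simp_all add: mem_ellipsoid_product ellipsoid_def)
    moreover have "left_part \<xi> \<bullet> (A *v left_part z) = 0" "right_part \<xi> \<bullet> (C *v right_part z) = 0"
      using \<xi> spd_symD[OF A, of "left_part \<xi>" "left_part z"] spd_symD[OF C, of "right_part \<xi>" "right_part z"]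
      by (simp_all only: tangent[OF z] product_tangent_def mem_Collect_eq)
    ultimately show ?thesis by (simp add: W_def)
  qed
  ultimately show thesis using lin by (intro that)
qed

text \<open>Replacing \<open>B\<close> by \<open>K\<close> changes nothing on tangent vectors, but makes \<open>x\<^sup>T K W(x)\<close> a function whose
  derivative at \<open>z\<close> loses the term with the derivative of \<open>W\<close>, as \<open>K z = 0\<close>. With the vanishing of the
  gradient, metric compatibility reduces to \<open>g(\<nabla>\<^sub>\<eta> grad f, \<xi>) = \<eta>\<^sup>T K \<xi>\<close> for every extension of \<open>\<eta>\<close>, so
  the Hessian is well defined.\<close>

lemma hessian_at_critical_point:
  fixes s :: real
  defines "K \<equiv> s *\<^sub>R blkdiag A C - B"
  assumes z: "z \<in> S" and crit: "K *v z = 0" and D: "levi_civita S g D" and \<eta>: "\<eta> \<in> tangent_space S z"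
  shows "riemannian_hessian S g D objective z \<eta> \<in> tangent_space S z"
    and "\<xi> \<in> tangent_space S z \<Longrightarrow> g z (riemannian_hessian S g D objective z \<eta>) \<xi> = \<eta> \<bullet> (K *v \<xi>)"
proof -
  let ?grad = "riemannian_grad S g objective"
  have AC_sym: "x \<bullet> (blkdiag A C *v y) = y \<bullet> (blkdiag A C *v x)" for x y
    by (rule spd_symD) (simp add: spd_blkdiag_iff A C)
  have K_apply: "x \<bullet> (K *v y) = s * (x \<bullet> (blkdiag A C *v y)) - x \<bullet> (B *v y)" for x y
    by (simp add: K_def matrix_vector_mult_diff_rdistrib inner_diff_right scaleR_matrix_vector_assoc[symmetric])
  have K_sym: "x \<bullet> (K *v y) = y \<bullet> (K *v x)" for x y
    using AC_sym[of x y] B_sym[of x y] by (simp add: K_apply)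
  have AC_tangent: "x \<bullet> (blkdiag A C *v \<xi>) = 0" if "x \<in> S" "\<xi> \<in> tangent_space S x" for x \<xi>
    using that by (simp add: tangent product_tangent_def blkdiag_mult inner_parts)
  have grad_K: "g x (?grad x) \<xi> = x \<bullet> (K *v \<xi>)" if "x \<in> S" "\<xi> \<in> tangent_space S x" for x \<xi>
    using gradient_riesz[OF that] AC_tangent[OF that] by (simp add: K_apply)
  have zK: "z \<bullet> (K *v x) = 0" for x using K_sym[of z x] crit by simp
  have grad0: "?grad z = 0"
  proof (rule riesz_unique[OF z gradient_tangent[OF z]])
    show "0 \<in> tangent_space S z"
      by (simp add: tangent[OF z] subspace_0[OF subspace_product_tangent])
    show "g z (?grad z) \<xi> = g z 0 \<xi>" if "\<xi> \<in> tangent_space S z" for \<xi>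
      using grad_K[OF z that] zK by (simp add: precond_metric_def)
  qed
  have conn: "D V ?grad z \<in> tangent_space S z"
    "\<xi> \<in> tangent_space S z \<Longrightarrow> g z (D V ?grad z) \<xi> = \<eta> \<bullet> (K *v \<xi>)"
    if V: "vector_field S V" "V z = \<eta>" for V \<xi>
  proof -
    have "affine_connection S D" using D by (simp only: levi_civita_def)
    from this[unfolded affine_connection_def, THEN conjunct1, rule_format, OF conjI[OF V(1) gradient_vector_field]]
    have "vector_field S (D V ?grad)" .
    then show "D V ?grad z \<in> tangent_space S z" using z by (simp add: vector_field_def)
    assume \<xi>: "\<xi> \<in> tangent_space S z"
    obtain W where W: "linear W" "vector_field S W" "W z = \<xi>" by (rule linear_tangent_field[OF z \<xi>])
    have WT: "W x \<in> tangent_space S x" if "x \<in> S" for x using W(2) that by (simp add: vector_field_def)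
    have bW: "bounded_linear (\<lambda>x. K *v W x)"
      using W(1) by (intro bounded_linear_compose[OF matrix_vector_mul_bounded_linear])
        (simp add: linear_conv_bounded_linear)
    have "dir_deriv S (\<lambda>x. g x (?grad x) (W x)) z \<eta> = z \<bullet> (K *v W \<eta>) + \<eta> \<bullet> (K *v W z)"
      by (rule dir_deriv_eq[OF \<eta> has_derivative_inner[OF has_derivative_ident
              bounded_linear_imp_has_derivative[OF bW]] open_UNIV])
         (simp_all add: grad_K WT)
    moreover have "dir_deriv S (\<lambda>x. g x (?grad x) (W x)) z (V z) =
        g z (D V ?grad z) (W z) + g z (?grad z) (D V W z)"
      by (rule D[unfolded levi_civita_def, THEN conjunct2, THEN conjunct2, rule_format,
            OF conjI[OF V(1) conjI[OF gradient_vector_field W(2)]] z])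
    ultimately show "g z (D V ?grad z) \<xi> = \<eta> \<bullet> (K *v \<xi>)"
      using V(2) W(3) zK grad0 by (simp add: precond_metric_def)
  qed
  obtain V where V: "vector_field S V" "V z = \<eta>" by (rule linear_tangent_field[OF z \<eta>])
  have "riemannian_hessian S g D objective z \<eta> = D V ?grad z"
    unfolding riemannian_hessian_def
  proof (rule the_equality)
    show "\<forall>V'. vector_field S V' \<and> V' z = \<eta> \<longrightarrow> D V' ?grad z = D V ?grad z"
      using conn V by (intro allI impI riesz_unique[OF z]) auto
    show "w = D V ?grad z" if "\<forall>V. vector_field S V \<and> V z = \<eta> \<longrightarrow> D V ?grad z = w" for w
      using that V by blast
  qed
  with conn[OF V] show "riemannian_hessian S g D objective z \<eta> \<in> tangent_space S z"
    and "\<xi> \<in> tangent_space S z \<Longrightarrow> g z (riemannian_hessian S g D objective z \<eta>) \<xi> = \<eta> \<bullet> (K *v \<xi>)"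
    by simp_all
qed

lemma hessian_eigenvalues:
  fixes s :: real
  defines "K \<equiv> s *\<^sub>R blkdiag A C - B"
  assumes z: "z \<in> S" and crit: "K *v z = 0" and D: "levi_civita S g D"
  shows "eigenvalues_on (tangent_space S z) (riemannian_hessian S g D objective z) =
    weak_eigenvalues (product_tangent A C z) K (M z)"
proof -
  let ?H = "riemannian_hessian S g D objective z"
  note H = hessian_at_critical_point[OF z crit[unfolded K_def] D, folded K_def]
  have K_sym: "x \<bullet> (K *v y) = y \<bullet> (K *v x)" for x y
    using spd_symD[of "blkdiag A C" x y] B_sym[of x y] A C
    by (simp add: K_def matrix_vector_mult_diff_rdistrib inner_diff_right spd_blkdiag_iff
        scaleR_matrix_vector_assoc[symmetric])
  have "?H \<eta> = \<mu> *\<^sub>R \<eta> \<longleftrightarrow> (\<forall>\<xi>\<in>tangent_space S z. \<xi> \<bullet> (K *v \<eta>) = \<mu> * (\<xi> \<bullet> (M z *v \<eta>)))"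
    if \<eta>: "\<eta> \<in> tangent_space S z" for \<eta> \<mu>
  proof -
    have sc: "\<mu> *\<^sub>R \<eta> \<in> tangent_space S z"
      using \<eta> subspace_scale[OF subspace_product_tangent] by (simp add: tangent[OF z])
    have gm: "g z (\<mu> *\<^sub>R \<eta>) \<xi> = \<mu> * (\<xi> \<bullet> (M z *v \<eta>))" for \<xi>
      using spd_symD[OF spd_M[OF z], of \<eta> \<xi>] by (simp add: precond_metric_def)
    show ?thesis
    proof
      assume "?H \<eta> = \<mu> *\<^sub>R \<eta>"
      then show "\<forall>\<xi>\<in>tangent_space S z. \<xi> \<bullet> (K *v \<eta>) = \<mu> * (\<xi> \<bullet> (M z *v \<eta>))"
        using H(2)[OF \<eta>] gm K_sym by metis
    next
      assume r: "\<forall>\<xi>\<in>tangent_space S z. \<xi> \<bullet> (K *v \<eta>) = \<mu> * (\<xi> \<bullet> (M z *v \<eta>))"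
      show "?H \<eta> = \<mu> *\<^sub>R \<eta>"
      proof (rule riesz_unique[OF z H(1)[OF \<eta>] sc])
        fix \<xi> assume \<xi>: "\<xi> \<in> tangent_space S z"
        show "g z (?H \<eta>) \<xi> = g z (\<mu> *\<^sub>R \<eta>) \<xi>"
          using H(2)[OF \<eta> \<xi>] r[rule_format, OF \<xi>] gm[of \<xi>] K_sym[of \<eta> \<xi>] by simp
      qed
    qed
  qed
  then show ?thesis
    unfolding eigenvalues_on_def weak_eigenvalues_def tangent[OF z, symmetric] by blast
qed

end

section \<open>Spectrum at the optimal pair\<close>

text \<open>Here \<open>s\<close> and \<open>t\<close> are the two largest canonical correlations, and \<open>\<phi>\<close>, \<open>\<psi>\<close> the leading singular vectors
  of the whitened cross-covariance \<open>R\<close>.\<close>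

locale cca_optimum = preconditioned_ellipsoids A C G M
  for A :: "real^'m^'m" and C :: "real^'n^'n" and G :: "real^'n^'m"
    and M :: "real^('m + 'n) \<Rightarrow> real^('m + 'n)^('m + 'n)" +
  fixes R :: "real^'n^'m" and s t :: real and \<phi> :: "real^'m" and \<psi> :: "real^'n"
  assumes R: "R = inv_sqrt A ** G ** inv_sqrt C"
    and sv: "unit_singular_vectors R s \<phi> \<psi>"
    and t: "t = singular_value R 2" and gap: "t < s"
    and dimension: "2 \<le> max CARD('m) CARD('n)"
begin

abbreviation "unwhiten a b \<equiv> vec_join (inv_sqrt A *v a) (inv_sqrt C *v b)"
abbreviation "zs \<equiv> unwhiten \<phi> \<psi>"
abbreviation "Sig \<equiv> blkdiag A C"
abbreviation "K \<equiv> s *\<^sub>R Sig - B"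
abbreviation "T \<equiv> product_tangent A C zs"

lemma t_nonneg: "0 \<le> t" by (simp add: t singular_value_nonneg)

lemma unwhiten_surj: obtains a b where "\<xi> = unwhiten a b"
  using inv_sqrt(2)[OF A] inv_sqrt(2)[OF C] by (metis vec_join_parts)

lemma unwhiten_Sig: "unwhiten a b \<bullet> (Sig *v unwhiten a' b') = a \<bullet> a' + b \<bullet> b'"
  by (simp add: blkdiag_mult inner_vec_join inv_sqrt(4)[OF A] inv_sqrt(4)[OF C])

lemma whitened_coupling: "(inv_sqrt A *v a) \<bullet> (G *v (inv_sqrt C *v b)) = a \<bullet> (R *v b)"
  by (simp add: R inv_sqrt(3)[OF A] matrix_vector_mul_assoc matrix_mul_assoc)

lemma unwhiten_B: "unwhiten a b \<bullet> (B *v unwhiten a' b') = a \<bullet> (R *v b') + a' \<bullet> (R *v b)"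
  by (simp only: inner_B parts_vec_join inner_transpose_mult whitened_coupling)

lemma unwhiten_K:
  "unwhiten a b \<bullet> (K *v unwhiten a' b') = s * (a \<bullet> a' + b \<bullet> b') - (a \<bullet> (R *v b') + a' \<bullet> (R *v b))"
  by (simp only: matrix_vector_mult_diff_rdistrib scaleR_matrix_vector_assoc[symmetric]
      inner_diff_right inner_scaleR_right unwhiten_Sig unwhiten_B)

lemma K_sym: "transpose K = K"
  unfolding symmetric_matrix_iff
proof (intro allI)
  fix x y
  obtain a b where x: "x = unwhiten a b" by (rule unwhiten_surj)
  obtain a' b' where y: "y = unwhiten a' b'" by (rule unwhiten_surj)
  show "x \<bullet> (K *v y) = y \<bullet> (K *v x)" unfolding x y unwhiten_K by (simp add: inner_commute)
qed

lemma unit: "\<phi> \<bullet> \<phi> = 1" "\<psi> \<bullet> \<psi> = 1"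
  and R\<psi>: "a \<bullet> (R *v \<psi>) = s * (a \<bullet> \<phi>)" and R\<phi>: "\<phi> \<bullet> (R *v b) = s * (b \<bullet> \<psi>)"
  using sv
  by (auto simp: unit_singular_vectors_def dot_square_norm inner_transpose_mult[symmetric]
      simp del: transpose_matrix_vector)

lemma zs_S: "zs \<in> S"
  by (simp add: mem_ellipsoid_product ellipsoid_def inv_sqrt(4)[OF A] inv_sqrt(4)[OF C] unit)

text \<open>The stationarity condition for the Lagrange multiplier \<open>s\<close>: in whitened coordinates it consists of
  the two singular vector equations.\<close>

lemma K_zs: "K *v zs = 0"
proof -
  have "x \<bullet> (K *v zs) = 0" for x
  proof -
    obtain a b where x: "x = unwhiten a b" by (rule unwhiten_surj)
    show ?thesis unfolding x unwhiten_K by (simp add: R\<psi> R\<phi> algebra_simps)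
  qed
  then show ?thesis by (metis inner_eq_zero_iff)
qed

lemma tangent_unwhiten: "unwhiten a b \<in> T \<longleftrightarrow> \<phi> \<bullet> a = 0 \<and> \<psi> \<bullet> b = 0"
  by (simp add: product_tangent_def inv_sqrt(4)[OF A] inv_sqrt(4)[OF C])

lemma unwhiten_eq_0: "unwhiten a b = 0 \<longleftrightarrow> a = 0 \<and> b = 0"
  using inv_sqrt(1)[OF A, of a] inv_sqrt(1)[OF C, of b] by (auto simp: vec_join_eq_0_iff)

text \<open>A factor of dimension at least two has a nonzero vector orthogonal to its singular vector.\<close>

lemma T_nontrivial: "T \<noteq> {0}"
proof -
  have "(\<exists>a. a \<noteq> 0 \<and> \<phi> \<bullet> a = 0) \<or> (\<exists>b. b \<noteq> 0 \<and> \<psi> \<bullet> b = 0)"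
  proof (cases "2 \<le> CARD('m)")
    case True
    have "dim {\<phi>} < DIM(real^'m)" using True dim_le_card[of "{\<phi>}" "{\<phi>}"] by (simp add: span_base)
    then obtain a where "a \<noteq> 0" "\<And>y. y \<in> span {\<phi>} \<Longrightarrow> orthogonal a y"
      by (rule orthogonal_to_subspace_exists) (rule that)
    then show ?thesis using span_base[of \<phi> "{\<phi>}"] by (auto simp: orthogonal_def inner_commute)
  next
    case False
    have "dim {\<psi>} < DIM(real^'n)" using False dimension dim_le_card[of "{\<psi>}" "{\<psi>}"] by (simp add: span_base)
    then obtain b where "b \<noteq> 0" "\<And>y. y \<in> span {\<psi>} \<Longrightarrow> orthogonal b y"
      by (rule orthogonal_to_subspace_exists) (rule that)
    then show ?thesis using span_base[of \<psi> "{\<psi>}"] by (auto simp: orthogonal_def inner_commute)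
  qed
  then show ?thesis
  proof
    assume "\<exists>a. a \<noteq> 0 \<and> \<phi> \<bullet> a = 0"
    then obtain a where "a \<noteq> 0" "\<phi> \<bullet> a = 0" by blast
    then have "unwhiten a 0 \<in> T" "unwhiten a 0 \<noteq> 0" by (simp_all only: tangent_unwhiten unwhiten_eq_0) simp_all
    then show ?thesis by blast
  next
    assume "\<exists>b. b \<noteq> 0 \<and> \<psi> \<bullet> b = 0"
    then obtain b where "b \<noteq> 0" "\<psi> \<bullet> b = 0" by blast
    then have "unwhiten 0 b \<in> T" "unwhiten 0 b \<noteq> 0" by (simp_all only: tangent_unwhiten unwhiten_eq_0) simp_all
    then show ?thesis by blast
  qed
qed

text \<open>The coupling term satisfies \<open>2 |a \<bullet> R b| \<le> 2 t |a| |b| \<le> t (|a|\<^sup>2 + |b|\<^sup>2)\<close> on the tangent space.\<close>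

lemma K_bounds:
  assumes "\<xi> \<in> T"
  shows "(s - t) * (\<xi> \<bullet> (Sig *v \<xi>)) \<le> \<xi> \<bullet> (K *v \<xi>)"
    and "\<xi> \<bullet> (K *v \<xi>) \<le> (s + t) * (\<xi> \<bullet> (Sig *v \<xi>))"
proof -
  obtain a b where \<xi>: "\<xi> = unwhiten a b" by (rule unwhiten_surj)
  have b: "\<psi> \<bullet> b = 0" using assms by (simp only: \<xi> tangent_unwhiten)
  have "\<bar>a \<bullet> (R *v b)\<bar> \<le> norm a * norm (R *v b)" by (rule Cauchy_Schwarz_ineq2)
  also have "\<dots> \<le> norm a * (t * norm b)"
    using operator_bound_orthogonal[OF sv _ b] gap by (intro mult_left_mono) (simp_all add: t)
  finally have "2 * \<bar>a \<bullet> (R *v b)\<bar> \<le> t * (2 * norm a * norm b)" by (simp add: mult_ac)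
  also have "\<dots> \<le> t * (a \<bullet> a + b \<bullet> b)"
    using sum_squares_bound[of "norm a" "norm b"] t_nonneg
    by (intro mult_left_mono) (simp_all add: dot_square_norm)
  finally have "2 * \<bar>a \<bullet> (R *v b)\<bar> \<le> t * (a \<bullet> a + b \<bullet> b)" .
  then show "(s - t) * (\<xi> \<bullet> (Sig *v \<xi>)) \<le> \<xi> \<bullet> (K *v \<xi>)"
    and "\<xi> \<bullet> (K *v \<xi>) \<le> (s + t) * (\<xi> \<bullet> (Sig *v \<xi>))"
    unfolding \<xi> unwhiten_K unwhiten_Sig by (simp_all add: left_diff_distrib distrib_right)
qed

lemma condition_number_le:
  "abs_ratio (weak_eigenvalues T K (M zs)) \<le> (s + t) / (s - t) * pencil_cond Sig (M zs)"
  using gap t_nonneg A C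
  by (intro preconditioned_eigenvalue_bounds subspace_product_tangent spd_M zs_S K_sym K_bounds T_nontrivial)
     (simp_all add: spd_blkdiag_iff)

text \<open>Singular vectors \<open>a\<close>, \<open>b\<close> for \<open>t > 0\<close> give the eigenvectors \<open>(a, b)\<close> and \<open>(a, - b)\<close>. For \<open>t = 0\<close> there
  may be no such pair, but then the two bounds coincide and every eigenvalue equals \<open>s\<close>.\<close>

lemma extreme_eigenvalues: "s - t \<in> weak_eigenvalues T K Sig" "s + t \<in> weak_eigenvalues T K Sig"
proof -
  have "s - t \<in> weak_eigenvalues T K Sig \<and> s + t \<in> weak_eigenvalues T K Sig"
  proof (cases "t = 0")
    case True
    have SigS: "spd Sig" using A C by (simp add: spd_blkdiag_iff)
    obtain \<mu> where \<mu>: "\<mu> \<in> weak_eigenvalues T K Sig"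
      by (rule weak_eigenvalue_lower_bound[OF subspace_product_tangent T_nontrivial K_sym SigS])
    obtain \<eta> where \<eta>: "\<eta> \<in> T" "\<eta> \<noteq> 0" "\<eta> \<bullet> (K *v \<eta>) = \<mu> * (\<eta> \<bullet> (Sig *v \<eta>))"
      by (rule weak_eigenvalue_rayleigh[OF \<mu>])
    then have "\<mu> = s" using K_bounds[OF \<eta>(1)] spd_posD[OF SigS \<eta>(2)] True by simp
    with \<mu> True show ?thesis by simp
  next
    case False
    then have pos: "0 < singular_value R 2" using t_nonneg t by simp
    have gap': "singular_value R 2 < s" using gap t by simp
    obtain a b where ab: "b \<noteq> 0" "R *v b = t *\<^sub>R a" "transpose R *v a = t *\<^sub>R b" "\<phi> \<bullet> a = 0" "\<psi> \<bullet> b = 0"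
      by (rule second_singular_vectors[OF sv gap' pos, folded t]) (rule that)
    have aR: "a \<bullet> (R *v b') = t * (b \<bullet> b')" for b'
      using inner_transpose_mult[of b' R a] ab(3) by (simp add: inner_commute)
    \<comment> \<open>The sign \<open>r\<close> is \<open>1\<close> or \<open>- 1\<close>.\<close>
    have eig: "s - r * t \<in> weak_eigenvalues T K Sig" if r: "r * r = 1" for r
      unfolding weak_eigenvalues_def
    proof (intro CollectI bexI conjI ballI)
      show "unwhiten a (r *\<^sub>R b) \<in> T" unfolding tangent_unwhiten using ab by simp
      show "unwhiten a (r *\<^sub>R b) \<noteq> 0" unfolding unwhiten_eq_0 using ab(1) r by auto
      fix \<xi>
      obtain a' b' where \<xi>: "\<xi> = unwhiten a' b'" by (rule unwhiten_surj)
      have "b \<bullet> b' = r * (r * (b \<bullet> b'))" using r by (simp add: mult.assoc[symmetric])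
      then have "t * (b \<bullet> b') = t * (r * (r * (b \<bullet> b')))" by simp
      then show "\<xi> \<bullet> (K *v unwhiten a (r *\<^sub>R b)) = (s - r * t) * (\<xi> \<bullet> (Sig *v unwhiten a (r *\<^sub>R b)))"
        unfolding \<xi> unwhiten_K unwhiten_Sig
        by (simp add: matrix_vector_mult_scaleR ab(2) aR inner_commute[of b'] algebra_simps)
    qed
    from eig[of 1] eig[of "-1"] show ?thesis by simp
  qed
  then show "s - t \<in> weak_eigenvalues T K Sig" "s + t \<in> weak_eigenvalues T K Sig" by auto
qed

lemma condition_number_eq:
  assumes "M zs = Sig"
  shows "abs_ratio (weak_eigenvalues T K (M zs)) = (s + t) / (s - t)"
proof (rule antisym)
  have SigS: "spd Sig" using A C by (simp add: spd_blkdiag_iff)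
  show "abs_ratio (weak_eigenvalues T K (M zs)) \<le> (s + t) / (s - t)"
    using condition_number_le pencil_cond_self[OF SigS] by (simp add: assms)
  have "0 < \<mu>" if \<mu>: "\<mu> \<in> weak_eigenvalues T K Sig" for \<mu>
  proof -
    obtain \<eta> where \<eta>: "\<eta> \<in> T" "\<eta> \<noteq> 0" "\<eta> \<bullet> (K *v \<eta>) = \<mu> * (\<eta> \<bullet> (Sig *v \<eta>))"
      by (rule weak_eigenvalue_rayleigh[OF \<mu>])
    then have "s - t \<le> \<mu>" using K_bounds(1)[OF \<eta>(1)] spd_posD[OF SigS \<eta>(2)] by simp
    then show ?thesis using gap by simp
  qed
  then show "(s + t) / (s - t) \<le> abs_ratio (weak_eigenvalues T K (M zs))"
    unfolding assms
    by (intro abs_ratio_ge finite_weak_eigenvalues K_sym SigS extreme_eigenvalues) auto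
qed

end

theorem lemma4p4:
  fixes X :: "real^'m^'k" and Y :: "real^'n^'k"
    and lam_x lam_y :: real
    and \<Sigma>xx :: "real^'m^'m" and \<Sigma>yy :: "real^'n^'n" and \<Sigma>xy :: "real^'n^'m"
    and \<Sigma> :: "real^('m + 'n)^('m + 'n)"
    and R :: "real^'n^'m" and \<sigma> :: "nat \<Rightarrow> real"
    and S :: "(real^('m + 'n)) set" and f :: "real^('m + 'n) \<Rightarrow> real"
    and \<phi> :: "real^'m" and \<psi> :: "real^'n" and zs :: "real^('m + 'n)"
    and M :: "real^('m + 'n) \<Rightarrow> real^('m + 'n)^('m + 'n)"
    and g :: "real^('m + 'n) \<Rightarrow> real^('m + 'n) \<Rightarrow> real^('m + 'n) \<Rightarrow> real"
    and D :: "(real^('m + 'n) \<Rightarrow> real^('m + 'n)) \<Rightarrow> (real^('m + 'n) \<Rightarrow> real^('m + 'n)) \<Rightarrow>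
              real^('m + 'n) \<Rightarrow> real^('m + 'n)"
    and \<kappa> :: real
  assumes "lam_x \<ge> 0" and "lam_y \<ge> 0"
    and "\<Sigma>xx = transpose X ** X + lam_x *\<^sub>R mat 1"
    and "\<Sigma>yy = transpose Y ** Y + lam_y *\<^sub>R mat 1"
    and "\<Sigma>xy = transpose X ** Y"
    and "\<Sigma> = blkdiag \<Sigma>xx \<Sigma>yy"
    and "spd \<Sigma>"
    and "R = inv_sqrt \<Sigma>xx ** \<Sigma>xy ** inv_sqrt \<Sigma>yy"
    and "\<sigma> = singular_value R"
    and "max (rank \<Sigma>xx) (rank \<Sigma>yy) \<ge> 2"
    and "\<sigma> 1 - \<sigma> 2 > 0"
    and "S = join_set (ellipsoid \<Sigma>xx) (ellipsoid \<Sigma>yy)"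
    and "f = (\<lambda>z. - (1/2) * (z \<bullet> (block_matrix 0 \<Sigma>xy (transpose \<Sigma>xy) 0 *v z)))"
    and "unit_singular_vectors R (\<sigma> 1) \<phi> \<psi>"
    and "zs = vec_join (inv_sqrt \<Sigma>xx *v \<phi>) (inv_sqrt \<Sigma>yy *v \<psi>)"
    and "smooth_preconditioning (ellipsoid \<Sigma>xx) (ellipsoid \<Sigma>yy) M"
    and "g = precond_metric M"
    and "levi_civita S g D"
    and "\<kappa> = condition_number_on (tangent_space S zs) (riemannian_hessian S g D f zs)"
  shows "(M zs = \<Sigma> \<longrightarrow> \<kappa> = (\<sigma> 1 + \<sigma> 2) / (\<sigma> 1 - \<sigma> 2)) \<and>
         \<kappa> \<le> (\<sigma> 1 + \<sigma> 2) / (\<sigma> 1 - \<sigma> 2) * pencil_cond \<Sigma> (M zs)"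
proof -
  have "2 \<le> max CARD('m) CARD('n)"
    using assms(10) rank_bound[of \<Sigma>xx] rank_bound[of \<Sigma>yy] by auto
  then interpret cca_optimum \<Sigma>xx \<Sigma>yy \<Sigma>xy M R "\<sigma> 1" "\<sigma> 2" \<phi> \<psi>
    using assms(6-9,11,14,16) by unfold_locales (simp_all add: spd_blkdiag_iff)
  have f: "f = objective" by (simp add: assms(13) objective_def[abs_def])
  have \<kappa>: "\<kappa> = abs_ratio (weak_eigenvalues (product_tangent \<Sigma>xx \<Sigma>yy zs)
      (\<sigma> 1 *\<^sub>R blkdiag \<Sigma>xx \<Sigma>yy - block_matrix 0 \<Sigma>xy (transpose \<Sigma>xy) 0) (M zs))"
    unfolding assms(19) condition_number_on_def f assms(12,15,17)
    by (rule arg_cong[OF hessian_eigenvalues[OF zs_S K_zs]]) (use assms(18) in \<open>simp only: assms(12,17)\<close>)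
  show ?thesis
  proof (intro conjI impI)
    show "\<kappa> = (\<sigma> 1 + \<sigma> 2) / (\<sigma> 1 - \<sigma> 2)" if "M zs = \<Sigma>"
      using condition_number_eq that unfolding \<kappa> assms(6,15) by blast
    show "\<kappa> \<le> (\<sigma> 1 + \<sigma> 2) / (\<sigma> 1 - \<sigma> 2) * pencil_cond \<Sigma> (M zs)"
      unfolding \<kappa> assms(6,15) by (rule condition_number_le)
  qed
qed

end
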